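(* Let $\boldsymbol{M}$ be a symmetric matrix, and $\preceq$ be a linear order on $V(\boldsymbol{M})$. If $\boldsymbol{M}$ with $\preceq$ has the $(k,\ell)$-red-potential property for some $k\le\ell$, then there is a symmetric $\ell$-contraction sequence of $\boldsymbol{M}$. Moreover, if the choice of the set $R$ in condition 2 of the definition of the $(k,\ell)$-red-potential property can be done in polynomial time, then an $\ell$-contraction sequence of $\boldsymbol{M}$ can also be found in polynomial time.
   Context: **Contractions.** Matrices are square with entries from a finite set containing a special *red* entry $r$, rows and columns indexed by the same set $V(\boldsymbol{M})$. The *red number* of a matrix is the maximum number of red entries over all its rows and columns. *Contraction* of rows (resp. columns) $p$ and $q$ gives the matrix obtained by deleting $q$ and replacing entries of $p$ by $r$ whenever they differ from the corresponding entries of $q$. A *contraction sequence* goes from the matrix down to a $1\times1$ matrix by successive contractions; it is *symmetric* if every contraction of a pair of rows (resp. columns) is immediately followed by the contraction of the corresponding pair of columns (resp. rows). A symmetric contraction sequence is a symmetric *$d$-contraction sequence* if every matrix in it has red number at most $d$, counted only after both the row contraction and the corresponding column contraction are performed. **Red potential.** Let $\boldsymbol{M}$ be a symmetric $(n\times n)$-matrix and $\preceq$ a linear order on $V(\boldsymbol{M})$. For $R\subseteq V(\boldsymbol{M})$, $S_R^\preceq$ denotes the successor (cover) relation of $\preceq$ restricted to $R$. $P_{\boldsymbol{M}}(u,v)$ denotes the number of red entries of the row created by contracting rows $u$ and $v$ in $\boldsymbol{M}$. The *red potential of $R$ in $\boldsymbol{M}$ with respect to $\preceq$* is $P^\preceq_{\boldsymbol{M},R}=\sum_{(u,v)\in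 S_R^\preceq}P_{\boldsymbol{M}}(u,v)$. **$(k,\ell)$-red-potential property** (defined recursively on $n$). $\boldsymbol{M}$ with $\preceq$ has the *$(k,\ell)$-red-potential property* if $n\le\ell$, or if all of the following hold: 1. the number of red entries in any row of $\boldsymbol{M}$ is at most $\ell$; 2. there exists a subset $R\subseteq V(\boldsymbol{M})$ such that the red potential of $R$ in $\boldsymbol{M}$ with respect to $\preceq$ is at most $(k+1)(|R|-1)-1$; and 3. for every pair of rows $(u,v)\in S_R^\preceq$ such that $P_{\boldsymbol{M}}(u,v)\le k$: if $\boldsymbol{M}'$ denotes the matrix obtained from $\boldsymbol{M}$ by contracting the rows $u$ with $v$ and then contracting the corresponding columns, then $\boldsymbol{M}'$ with the order inherited from $\preceq$ on $V(\boldsymbol{M}')$ has again the $(k,\ell)$-red-potential property. (Here the set $R$ in condition 3 is the one chosen in condition 2.) *)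

theory Defs
  imports "HOL-Computational_Algebra.Polynomial"
begin

section \<open>Matrices and contractions\<close>

text \<open>
  The row and the column index set are kept apart, because halfway through a symmetric contraction
  step (one row deleted, the corresponding column still present) they differ. The values of
  \<open>entry\<close> outside of \<open>rows \<times> cols\<close> are irrelevant. Throughout, \<open>r\<close> is the red entry.
\<close>

record ('v, 'e) matrix =
  rows :: "'v set"
  cols :: "'v set"
  entry :: "'v \<Rightarrow> 'v \<Rightarrow> 'e"

definition symmetric_matrix :: "'e set \<Rightarrow> ('v, 'e) matrix \<Rightarrow> bool" where
  "symmetric_matrix A M \<longleftrightarrow>
     finite (rows M) \<and> rows M \<noteq> {} \<and> cols M = rows M \<and>
     (\<forall>u\<in>rows M. \<forall>v\<in>rows M. entry M u v \<in> A \<and> entry M u v = entry M v u)"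

definition row_red :: "'e \<Rightarrow> ('v, 'e) matrix \<Rightarrow> 'v \<Rightarrow> nat" where
  "row_red r M u = card {v \<in> cols M. entry M u v = r}"

definition col_red :: "'e \<Rightarrow> ('v, 'e) matrix \<Rightarrow> 'v \<Rightarrow> nat" where
  "col_red r M v = card {u \<in> rows M. entry M u v = r}"

definition red_number :: "'e \<Rightarrow> ('v, 'e) matrix \<Rightarrow> nat" where
  "red_number r M = Max (row_red r M ` rows M \<union> col_red r M ` cols M)"

text \<open>\<open>Rows p q\<close> contracts the rows \<open>p\<close> and \<open>q\<close>; it is \<open>q\<close> that gets deleted.\<close>

datatype 'v contraction = Rows 'v 'v | Cols 'v 'v

fun contract :: "'e \<Rightarrow> 'v contraction \<Rightarrow> ('v, 'e) matrix \<Rightarrow> ('v, 'e) matrix" where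
  "contract r (Rows p q) M =
     M\<lparr>rows := rows M - {q},
       entry := \<lambda>x y. if x = p \<and> entry M p y \<noteq> entry M q y then r else entry M x y\<rparr>"
| "contract r (Cols p q) M =
     M\<lparr>cols := cols M - {q},
       entry := \<lambda>x y. if y = p \<and> entry M x p \<noteq> entry M x q then r else entry M x y\<rparr>"

fun contractible :: "('v, 'e) matrix \<Rightarrow> 'v contraction \<Rightarrow> bool" where
  "contractible M (Rows p q) \<longleftrightarrow> p \<in> rows M \<and> q \<in> rows M \<and> p \<noteq> q"
| "contractible M (Cols p q) \<longleftrightarrow> p \<in> cols M \<and> q \<in> cols M \<and> p \<noteq> q"

text \<open>
  A contraction sequence of a given matrix is represented by the list of the contractions performed;
  the \<open>i\<close>-th matrix of the sequence is \<open>fold (contract r) (take i cs) M\<close>.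
\<close>

fun contraction_sequence :: "'e \<Rightarrow> ('v, 'e) matrix \<Rightarrow> 'v contraction list \<Rightarrow> bool" where
  "contraction_sequence r M [] \<longleftrightarrow> card (rows M) = 1 \<and> card (cols M) = 1"
| "contraction_sequence r M (c # cs) \<longleftrightarrow>
     contractible M c \<and> contraction_sequence r (contract r c M) cs"

fun corresponding :: "'v contraction \<Rightarrow> 'v contraction" where
  "corresponding (Rows p q) = Cols p q"
| "corresponding (Cols p q) = Rows p q"

fun symmetric_steps :: "'v contraction list \<Rightarrow> bool" where
  "symmetric_steps [] \<longleftrightarrow> True"
| "symmetric_steps [c] \<longleftrightarrow> False"
| "symmetric_steps (c # c' # cs) \<longleftrightarrow> c' = corresponding c \<and> symmetric_steps cs"

text \<open>
  The red number is only inspected at even positions, that is, after both halves of a step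
  (and for \<open>M\<close> itself).
\<close>

definition symmetric_d_contraction_sequence ::
    "'e \<Rightarrow> nat \<Rightarrow> ('v, 'e) matrix \<Rightarrow> 'v contraction list \<Rightarrow> bool" where
  "symmetric_d_contraction_sequence r d M cs \<longleftrightarrow>
     contraction_sequence r M cs \<and> symmetric_steps cs \<and>
     (\<forall>i\<le>length cs. even i \<longrightarrow> red_number r (fold (contract r) (take i cs) M) \<le> d)"


section \<open>The red potential\<close>

text \<open>
  The cover relation of the order \<open>ord\<close> restricted to \<open>R\<close>; a pair \<open>(u, v)\<close> in it has \<open>u\<close> below \<open>v\<close>.
\<close>

definition successor_rel :: "'v rel \<Rightarrow> 'v set \<Rightarrow> 'v rel" where
  "successor_rel ord R =
     {(u, v). u \<in> R \<and> v \<in> R \<and> u \<noteq> v \<and> (u, v) \<in> ord \<and>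
        \<not> (\<exists>w\<in>R. w \<noteq> u \<and> w \<noteq> v \<and> (u, w) \<in> ord \<and> (w, v) \<in> ord)}"

definition pair_red :: "'e \<Rightarrow> ('v, 'e) matrix \<Rightarrow> 'v \<Rightarrow> 'v \<Rightarrow> nat" where
  "pair_red r M u v = row_red r (contract r (Rows u v) M) u"

definition red_potential :: "'e \<Rightarrow> ('v, 'e) matrix \<Rightarrow> 'v rel \<Rightarrow> 'v set \<Rightarrow> nat" where
  "red_potential r M ord R = (\<Sum>(u, v)\<in>successor_rel ord R. pair_red r M u v)"

definition small_red_potential ::
    "'e \<Rightarrow> nat \<Rightarrow> ('v, 'e) matrix \<Rightarrow> 'v rel \<Rightarrow> 'v set \<Rightarrow> bool" where
  "small_red_potential r k M ord R \<longleftrightarrow>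
     R \<subseteq> rows M \<and> int (red_potential r M ord R) \<le> (int k + 1) * (int (card R) - 1) - 1"

definition contract_pair :: "'e \<Rightarrow> 'v \<Rightarrow> 'v \<Rightarrow> ('v, 'e) matrix \<Rightarrow> ('v, 'e) matrix" where
  "contract_pair r u v M = contract r (Cols u v) (contract r (Rows u v) M)"

inductive red_potential_property ::
    "'e \<Rightarrow> nat \<Rightarrow> nat \<Rightarrow> ('v, 'e) matrix \<Rightarrow> 'v rel \<Rightarrow> bool" for r k l where
  small: "card (rows M) \<le> l \<Longrightarrow> red_potential_property r k l M ord"
| step: "\<lbrakk>\<forall>u\<in>rows M. row_red r M u \<le> l;
          small_red_potential r k M ord R;
          \<And>u v. \<lbrakk>(u, v) \<in> successor_rel ord R; pair_red r M u v \<le> k\<rbrakk> \<Longrightarrow>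
             red_potential_property r k l (contract_pair r u v M) (Restr ord (rows M - {v}))\<rbrakk>
        \<Longrightarrow> red_potential_property r k l M ord"

text \<open>
  The same property, with the set \<open>R\<close> chosen by the function \<open>choice\<close> throughout the recursion.
\<close>

inductive red_potential_property_by ::
    "(('v, 'e) matrix \<Rightarrow> 'v rel \<Rightarrow> 'v set) \<Rightarrow>
     'e \<Rightarrow> nat \<Rightarrow> nat \<Rightarrow> ('v, 'e) matrix \<Rightarrow> 'v rel \<Rightarrow> bool" for choice r k l where
  small: "card (rows M) \<le> l \<Longrightarrow> red_potential_property_by choice r k l M ord"
| step: "\<lbrakk>\<forall>u\<in>rows M. row_red r M u \<le> l;
          small_red_potential r k M ord (choice M ord);
          \<And>u v. \<lbrakk>(u, v) \<in> successor_rel ord (choice M ord); pair_red r M u v \<le> k\<rbrakk> \<Longrightarrow>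
             red_potential_property_by choice r k l
               (contract_pair r u v M) (Restr ord (rows M - {v}))\<rbrakk>
        \<Longrightarrow> red_potential_property_by choice r k l M ord"

lemma rows_contract_pair [simp]: "rows (contract_pair r u v M) = rows M - {v}"
  by (simp add: contract_pair_def)

theorem red_potential_property_iff_by:
  assumes "finite (rows M)"
  shows "red_potential_property r k l M ord \<longleftrightarrow>
    (\<exists>choice. red_potential_property_by choice r k l M ord)"
proof
  define good where "good M ord R \<longleftrightarrow> small_red_potential r k M ord R \<and>
      (\<forall>u v. (u, v) \<in> successor_rel ord R \<longrightarrow> pair_red r M u v \<le> k \<longrightarrow>
        red_potential_property r k l (contract_pair r u v M) (Restr ord (rows M - {v})))"
    for M :: "('a, 'b) matrix" and ord R
  define choice where "choice M ord = (SOME R. good M ord R)" for M :: "('a, 'b) matrix" and ord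
  have "red_potential_property_by choice r k l M ord"
    if "red_potential_property r k l M ord" "finite (rows M)" for M ord
    using that
  proof (induction "card (rows M)" arbitrary: M ord rule: less_induct)
    case less
    show ?case
    proof (cases "card (rows M) \<le> l")
      case True
      then show ?thesis by (rule red_potential_property_by.small)
    next
      case False
      from less.prems(1) False obtain R where red: "\<forall>u\<in>rows M. row_red r M u \<le> l"
          and "small_red_potential r k M ord R"
          and "\<And>u v. \<lbrakk>(u, v) \<in> successor_rel ord R; pair_red r M u v \<le> k\<rbrakk> \<Longrightarrow>
            red_potential_property r k l (contract_pair r u v M) (Restr ord (rows M - {v}))"
        by cases simp_all
      then have ex: "\<exists>R. good M ord R"
        unfolding good_def by (intro exI[of _ R]) simp
      from ex have good: "good M ord (choice M ord)"
        unfolding choice_def by (rule someI_ex)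
      show ?thesis
      proof (rule red_potential_property_by.step)
        show "\<forall>u\<in>rows M. row_red r M u \<le> l" by (fact red)
        show "small_red_potential r k M ord (choice M ord)" using good by (simp add: good_def)
        fix u v
        assume uv: "(u, v) \<in> successor_rel ord (choice M ord)" "pair_red r M u v \<le> k"
        have "v \<in> rows M"
          using uv(1) good by (auto simp: good_def small_red_potential_def successor_rel_def)
        then have "card (rows (contract_pair r u v M)) < card (rows M)"
          using less.prems(2) by (simp only: rows_contract_pair card_Diff1_less)
        moreover have "red_potential_property r k l (contract_pair r u v M)
            (Restr ord (rows M - {v}))"
          using good uv by (simp add: good_def)
        ultimately show "red_potential_property_by choice r k l (contract_pair r u v M)
            (Restr ord (rows M - {v}))"
          using less.hyps less.prems(2) by simp
      qed
    qed
  qed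
  then show "\<exists>choice. red_potential_property_by choice r k l M ord"
    if "red_potential_property r k l M ord"
    using that assms by blast
next
  assume "\<exists>choice. red_potential_property_by choice r k l M ord"
  then obtain choice where "red_potential_property_by choice r k l M ord" ..
  then show "red_potential_property r k l M ord"
    by induction (fact red_potential_property.small, rule red_potential_property.step)
qed


section \<open>Polynomial time\<close>

text \<open>
  The model of computation is a while-language whose single variable holds a binary tree (in the
  style of the language I of N. D. Jones). In \<open>exec p x t y\<close>, the program \<open>p\<close>
  halts on input \<open>x\<close> with output \<open>y\<close> in time \<open>t\<close>. Every elementary operation is charged for the
  full size of the trees that it reads and writes, so running times agree with those of Turing
  machines up to a polynomial. The tree \<open>Leaf\<close> serves as the truth value false.
\<close>

datatype tree = Leaf | Node tree tree

datatype prog =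
    Const tree
  | Ident
  | Left
  | Right
  | Equal
  | Pair prog prog
  | Seq prog prog
  | While prog prog

inductive exec :: "prog \<Rightarrow> tree \<Rightarrow> nat \<Rightarrow> tree \<Rightarrow> bool" where
  Const: "exec (Const c) x (1 + size x + size c) c"
| Ident: "exec Ident x (1 + size x) x"
| Left: "exec Left (Node a b) (1 + size (Node a b)) a"
| Left_Leaf: "exec Left Leaf 1 Leaf"
| Right: "exec Right (Node a b) (1 + size (Node a b)) b"
| Right_Leaf: "exec Right Leaf 1 Leaf"
| Equal: "exec Equal (Node a b) (1 + size (Node a b)) (if a = b then Node Leaf Leaf else Leaf)"
| Equal_Leaf: "exec Equal Leaf 1 Leaf"
| Pair: "\<lbrakk>exec p x s y; exec q x t z\<rbrakk> \<Longrightarrow> exec (Pair p q) x (1 + s + t) (Node y z)"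
| Seq: "\<lbrakk>exec p x s y; exec q y t z\<rbrakk> \<Longrightarrow> exec (Seq p q) x (1 + s + t) z"
| While_False: "exec p x s Leaf \<Longrightarrow> exec (While p q) x (1 + s) x"
| While_True: "\<lbrakk>exec p x s b; b \<noteq> Leaf; exec q x t y; exec (While p q) y t' z\<rbrakk>
    \<Longrightarrow> exec (While p q) x (1 + s + t + t') z"

lemma exec_size: "exec p x t y \<Longrightarrow> size x \<le> t \<and> size y \<le> t"
  by (induction rule: exec.induct) auto

lemma exec_deterministic: "exec p x t y \<Longrightarrow> exec p x t' y' \<Longrightarrow> t' = t \<and> y' = y"
proof (induction arbitrary: t' y' rule: exec.induct)
  case (Pair p x s y q t z)
  from Pair.prems show ?case by cases (auto dest!: Pair.IH)
next
  case (Seq p x s y q t z)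
  from Seq.prems show ?case by cases (auto dest!: Seq.IH)
next
  case (While_False p x s q)
  from While_False.prems show ?case by cases (auto dest!: While_False.IH)
next
  case (While_True p x s b q t y t1 z)
  from While_True.prems show ?case by cases (use While_True.hyps in \<open>auto dest!: While_True.IH\<close>)
qed (erule exec.cases; simp; fail)+

text \<open>
  \<open>poly_time_on D enc sol\<close>: some program, given \<open>enc x\<close> for any instance \<open>x\<close> in \<open>D\<close>, outputs an
  element of \<open>sol x\<close> in time polynomial in the size of \<open>enc x\<close>; nothing is required of it on other
  inputs.
\<close>

definition poly_time_on :: "'i set \<Rightarrow> ('i \<Rightarrow> tree) \<Rightarrow> ('i \<Rightarrow> tree set) \<Rightarrow> bool" where
  "poly_time_on D enc sol \<longleftrightarrow>
     (\<exists>p (b :: nat poly). \<forall>x\<in>D. \<exists>t y. exec p (enc x) t y \<and> t \<le> poly b (size (enc x)) \<and> y \<in> sol x)"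

fun enc_nat :: "nat \<Rightarrow> tree" where
  "enc_nat 0 = Leaf"
| "enc_nat (Suc n) = Node Leaf (enc_nat n)"

fun enc_list :: "('a \<Rightarrow> tree) \<Rightarrow> 'a list \<Rightarrow> tree" where
  "enc_list f [] = Leaf"
| "enc_list f (x # xs) = Node (f x) (enc_list f xs)"

fun enc_contraction :: "('v \<Rightarrow> tree) \<Rightarrow> 'v contraction \<Rightarrow> tree" where
  "enc_contraction f (Rows p q) = Node Leaf (Node (f p) (f q))"
| "enc_contraction f (Cols p q) = Node (Node Leaf Leaf) (Node (f p) (f q))"

definition order_list :: "'v rel \<Rightarrow> 'v set \<Rightarrow> 'v list" where
  "order_list ord V =
     (THE vs. set vs = V \<and> distinct vs \<and> sorted_wrt (\<lambda>u v. (u, v) \<in> ord) vs)"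

type_synonym ('v, 'e) inst = "nat \<times> nat \<times> ('v, 'e) matrix \<times> 'v rel"

text \<open>
  An instance consists of the parameters \<open>k\<close> and \<open>l\<close>, a square matrix and an order on its index set.
  It is presented as \<open>k\<close>, \<open>l\<close>, the list of the indices in increasing order, and the list of the rows,
  with rows and columns in that order. Writing \<open>k\<close> and \<open>l\<close> in unary is harmless, as the property
  holds trivially once \<open>l\<close> reaches the number of rows. Index names and entries are written by means of
  arbitrary encodings \<open>fv\<close> and \<open>fe\<close>.
\<close>

fun enc_inst :: "('v \<Rightarrow> tree) \<Rightarrow> ('e \<Rightarrow> tree) \<Rightarrow> ('v, 'e) inst \<Rightarrow> tree" where
  "enc_inst fv fe (k, l, M, ord) =
     (let vs = order_list ord (rows M) in
      Node (enc_nat k) (Node (enc_nat l) (Node (enc_list fv vs)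
        (enc_list (\<lambda>u. enc_list (\<lambda>v. fe (entry M u v)) vs) vs))))"

text \<open>
  The instances whose red potential property is witnessed by the choice function. The parameters are
  part of the instance; a fixed pair is covered by a choice function that returns the empty set (and
  so witnesses nothing beyond the trivial case) for all the other pairs.
\<close>

definition instances ::
    "'e set \<Rightarrow> 'e \<Rightarrow> (nat \<Rightarrow> nat \<Rightarrow> ('v, 'e) matrix \<Rightarrow> 'v rel \<Rightarrow> 'v set) \<Rightarrow> ('v, 'e) inst set" where
  "instances A r choice =
     {(k, l, M, ord). k \<le> l \<and> symmetric_matrix A M \<and> linear_order_on (rows M) ord \<and>
        red_potential_property_by (choice k l) r k l M ord}"

text \<open>
  The set \<open>R\<close> only has to be computed when there are more than \<open>l\<close> rows. It is output as a list
  in any order, possibly with repetitions.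
\<close>

definition poly_time_choice ::
    "('v \<Rightarrow> tree) \<Rightarrow> ('e \<Rightarrow> tree) \<Rightarrow> 'e set \<Rightarrow> 'e \<Rightarrow>
     (nat \<Rightarrow> nat \<Rightarrow> ('v, 'e) matrix \<Rightarrow> 'v rel \<Rightarrow> 'v set) \<Rightarrow> bool" where
  "poly_time_choice fv fe A r choice \<longleftrightarrow>
     poly_time_on {(k, l, M, ord) \<in> instances A r choice. card (rows M) > l}
       (enc_inst fv fe)
       (\<lambda>(k, l, M, ord). {enc_list fv us | us. set us = choice k l M ord})"

definition poly_time_contraction ::
    "('v \<Rightarrow> tree) \<Rightarrow> ('e \<Rightarrow> tree) \<Rightarrow> 'e set \<Rightarrow> 'e \<Rightarrow>
     (nat \<Rightarrow> nat \<Rightarrow> ('v, 'e) matrix \<Rightarrow> 'v rel \<Rightarrow> 'v set) \<Rightarrow> bool" where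
  "poly_time_contraction fv fe A r choice \<longleftrightarrow>
     poly_time_on (instances A r choice)
       (enc_inst fv fe)
       (\<lambda>(k, l, M, ord). {enc_list (enc_contraction fv) cs | cs.
          symmetric_d_contraction_sequence r l M cs})"

end

theory Submission
  imports Defs
begin

text \<open>
  As the red potential of \<open>R\<close> is less than \<open>(k + 1) (|R| - 1)\<close>, one of the \<open>|R| - 1\<close> successor pairs
  creates at most \<open>k\<close> red entries. Contracting it stays within the red-potential property, whose first
  condition bounds the red number, and one repeats this until at most \<open>l\<close> rows are left; from then on
  every symmetric contraction sequence has red number at most \<open>l\<close>.

  For the running time, the functions computable in polynomial time are closed under composition,
  pairing, case distinction and folds whose accumulator grows additively, and each step of the above
  is such a function of the encoded instance. The main loop makes fewer steps than there are rows, and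
  its states stay polynomial in the size of the input because all entries lie in the finite set \<open>A\<close>,
  so their encodings have bounded size.
\<close>

section \<open>Symmetric contractions\<close>

text \<open>The choice program may return any list that enumerates \<open>R\<close>, and promises
  something only on instances with more than \<open>l\<close> rows. Therefore
  \<open>poly_time_on\<close> carries a domain and a set of admissible outputs, and the main loop is
  governed by an invariant relation: every state must again hold an instance witnessed by the same
  \<open>choice\<close>. The rest of a round is a total function on trees, handled by
  \<open>polytime\<close>. Condition 3 covers every successor pair that creates at most
  \<open>k\<close> red entries, so the program may take the first such pair it meets; averaging only
  has to show that there is one. Programs have one variable and no conditional. Branching is thus a
  loop that runs at most once, and a fold carries its whole input along in the state. Iterating a
  polynomial-time round could still blow up the state. Every state is therefore bounded in terms of
  the original input: index names are only deleted, and each round records just two contractions of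
  named indices.\<close>

lemma symmetric_matrix_contract_pair:
  assumes "symmetric_matrix A M" and "r \<in> A" and "u \<in> rows M" and "v \<in> rows M" and "u \<noteq> v"
  shows "symmetric_matrix A (contract_pair r u v M)"
proof -
  have M: "finite (rows M)" "cols M = rows M"
    "\<And>x y. x \<in> rows M \<Longrightarrow> y \<in> rows M \<Longrightarrow> entry M x y \<in> A"
    "\<And>x y. x \<in> rows M \<Longrightarrow> y \<in> rows M \<Longrightarrow> entry M x y = entry M y x"
    using assms(1) by (auto simp: symmetric_matrix_def)
  have "entry (contract_pair r u v M) x y \<in> A" if "x \<in> rows M" "y \<in> rows M" for x y
  proof -
    have "entry (contract_pair r u v M) x y \<in> {r, entry M x y}" by (simp add: contract_pair_def)
    then show ?thesis using M(3)[OF that] \<open>r \<in> A\<close> by auto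
  qed
  \<comment> \<open>Off the diagonal an entry of row \<open>u\<close> can change only in the row
    half and an entry of column \<open>u\<close> only in the column half; by symmetry of
    \<open>M\<close> both halves compare the same two values.\<close>
  moreover have "entry (contract_pair r u v M) x y = entry (contract_pair r u v M) y x"
    if "x \<in> rows M" "y \<in> rows M" for x y
    using M(4)[OF that] M(4)[OF that(1) assms(3)] M(4)[OF that(2) assms(3)]
      M(4)[OF that(1) assms(4)] M(4)[OF that(2) assms(4)]
    by (simp add: contract_pair_def)
  moreover have "rows M - {v} \<noteq> {}" using assms(3,5) by blast
  moreover have "cols (contract_pair r u v M) = rows (contract_pair r u v M)"
    using M(2) by (simp add: contract_pair_def)
  ultimately show ?thesis
    using M(1) unfolding symmetric_matrix_def by auto
qed

text \<open>The intermediate matrix, with the row but not yet the column contracted, sits at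
  position 1, which is odd and so not inspected; later even positions shift by two.\<close>

lemma symmetric_d_contraction_sequence_Cons:
  assumes "cols M = rows M" and "u \<in> rows M" and "v \<in> rows M" and "u \<noteq> v" and "red_number r M \<le> d"
    and cs: "symmetric_d_contraction_sequence r d (contract_pair r u v M) cs"
  shows "symmetric_d_contraction_sequence r d M (Rows u v # Cols u v # cs)"
proof -
  have "red_number r (fold (contract r) (take i (Rows u v # Cols u v # cs)) M) \<le> d"
    if "i \<le> length (Rows u v # Cols u v # cs)" "even i" for i
  proof (cases i)
    case (Suc j)
    with that obtain j' where "i = Suc (Suc j')" "j' \<le> length cs" "even j'"
      by (cases j) auto
    then show ?thesis
      using cs by (simp add: symmetric_d_contraction_sequence_def contract_pair_def)
  qed (use assms(5) in simp)
  then show ?thesis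
    using assms by (simp add: symmetric_d_contraction_sequence_def contract_pair_def)
qed

text \<open>Condition 1 of the property speaks of rows only; symmetry carries the bound over to
  columns.\<close>

lemma red_number_le:
  assumes "symmetric_matrix A M" and "\<forall>u\<in>rows M. row_red r M u \<le> d"
  shows "red_number r M \<le> d"
proof -
  have M: "finite (rows M)" "rows M \<noteq> {}" "cols M = rows M"
    "\<And>u v. u \<in> rows M \<Longrightarrow> v \<in> rows M \<Longrightarrow> entry M u v = entry M v u"
    using assms(1) by (auto simp: symmetric_matrix_def)
  have "col_red r M v = row_red r M v" if "v \<in> rows M" for v
    unfolding col_red_def row_red_def M(3) using M(4)[OF that] by metis
  then show ?thesis
    unfolding red_number_def using M(1-3) assms(2) by (subst Max_le_iff) auto
qed

lemma red_number_le_card: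
  assumes "symmetric_matrix A M"
  shows "red_number r M \<le> card (rows M)"
  using assms
  by (intro red_number_le) (auto simp: row_red_def symmetric_matrix_def intro!: card_mono)

definition contract_to :: "'v \<Rightarrow> 'v list \<Rightarrow> 'v contraction list" where
  "contract_to u vs = concat (map (\<lambda>v. [Rows u v, Cols u v]) vs)"

lemma contract_to_sequence:
  assumes "symmetric_matrix A M" and "r \<in> A" and "card (rows M) \<le> d"
    and "distinct (u # vs)" and "set (u # vs) = rows M"
  shows "symmetric_d_contraction_sequence r d M (contract_to u vs)"
  using assms
proof (induction vs arbitrary: M)
  case Nil
  then have "rows M = {u}" "cols M = {u}" by (auto simp: symmetric_matrix_def)
  then show ?case
    using red_number_le_card[OF Nil.prems(1), of r] Nil.prems(3)
    by (simp add: symmetric_d_contraction_sequence_def contract_to_def)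
next
  case (Cons v vs)
  have M: "cols M = rows M" "finite (rows M)" "u \<in> rows M" "v \<in> rows M" "u \<noteq> v"
    using Cons.prems by (auto simp: symmetric_matrix_def)
  have "symmetric_d_contraction_sequence r d (contract_pair r u v M) (contract_to u vs)"
  proof (rule Cons.IH)
    show "symmetric_matrix A (contract_pair r u v M)"
      using Cons.prems M by (intro symmetric_matrix_contract_pair)
    show "card (rows (contract_pair r u v M)) \<le> d"
      using Cons.prems(3) M(2) card_mono[of "rows M" "rows M - {v}"] by simp
    show "set (u # vs) = rows (contract_pair r u v M)"
      using Cons.prems(4,5) by auto
  qed (use Cons.prems in auto)
  moreover have "red_number r M \<le> d"
    using red_number_le_card[OF Cons.prems(1), of r] Cons.prems(3) by simp
  ultimately show ?case
    using symmetric_d_contraction_sequence_Cons[OF M(1,3-5)] by (simp add: contract_to_def)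
qed

section \<open>Finite linear orders as lists\<close>

lemma linear_order_on_Restr:
  "linear_order_on V ord \<Longrightarrow> W \<subseteq> V \<Longrightarrow> linear_order_on W (Restr ord W)"
  unfolding order_on_defs refl_on_def total_on_def trans_def antisym_def by blast

text \<open>If the heads differed, each would occur in the tail of the other list, against
  antisymmetry. With \<open>ex_sorted_list\<close> this makes the description in
  \<open>order_list\<close> well defined.\<close>

lemma sorted_wrt_unique:
  assumes "antisym ord" and "distinct vs" and "distinct ws" and "set vs = set ws"
    and "sorted_wrt (\<lambda>u v. (u, v) \<in> ord) vs" and "sorted_wrt (\<lambda>u v. (u, v) \<in> ord) ws"
  shows "vs = ws"
  using assms(2-)
proof (induction vs arbitrary: ws)
  case (Cons v vs)
  then obtain w ws' where ws: "ws = w # ws'" by (cases ws) auto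
  have "v = w"
  proof (rule ccontr)
    assume "v \<noteq> w"
    moreover from this have "v \<in> set ws'" "w \<in> set vs" using Cons.prems(3) ws by auto
    ultimately show False
      using Cons.prems(4,5) ws antisymD[OF assms(1)] by auto
  qed
  moreover from this have "set vs = set ws'"
    using Cons.prems(1-3) ws by (simp add: insert_ident)
  ultimately show ?case using Cons ws by simp
qed simp

lemma ex_sorted_list:
  assumes "linear_order_on V ord" and "finite W" and "W \<subseteq> V"
  shows "\<exists>vs. set vs = W \<and> distinct vs \<and> sorted_wrt (\<lambda>u v. (u, v) \<in> ord) vs"
  using assms(2,3)
proof (induction W rule: finite_induct)
  case (insert a W)
  then obtain vs where vs: "set vs = W" "distinct vs" "sorted_wrt (\<lambda>u v. (u, v) \<in> ord) vs"
    by auto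
  \<comment> \<open>Insertion of \<open>a\<close>: totality puts the elements not below
    \<open>a\<close> above it, and transitivity through \<open>a\<close> orders the two
    halves.\<close>
  let ?vs = "filter (\<lambda>x. (x, a) \<in> ord) vs @ a # filter (\<lambda>x. (x, a) \<notin> ord) vs"
  have total: "(a, y) \<in> ord" if "y \<in> W" "(y, a) \<notin> ord" for y
    using assms(1) that insert.prems insert.hyps
    by (auto simp: linear_order_on_def total_on_def)
  have trans: "trans ord" using assms(1) by (simp add: order_on_defs)
  have "sorted_wrt (\<lambda>u v. (u, v) \<in> ord) ?vs"
    using vs total by (auto simp: sorted_wrt_append intro: sorted_wrt_filter transD[OF trans])
  moreover have "set ?vs = insert a W" "distinct ?vs" using vs insert.hyps by auto
  ultimately show ?case by blast
qed simp

lemma order_list_eqI: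
  assumes "linear_order_on V ord" and "distinct vs" and "set vs = V"
    and "sorted_wrt (\<lambda>u v. (u, v) \<in> ord) vs"
  shows "order_list ord V = vs"
  unfolding order_list_def
  using assms by (intro the_equality sorted_wrt_unique[of ord]) (auto simp: order_on_defs)

lemma order_list:
  assumes "linear_order_on V ord" and "finite V"
  shows "set (order_list ord V) = V" and "distinct (order_list ord V)"
    and "sorted_wrt (\<lambda>u v. (u, v) \<in> ord) (order_list ord V)"
proof -
  obtain vs where "set vs = V" "distinct vs" "sorted_wrt (\<lambda>u v. (u, v) \<in> ord) vs"
    using ex_sorted_list[OF assms order_refl] by blast
  with order_list_eqI[OF assms(1)]
  show "set (order_list ord V) = V" "distinct (order_list ord V)"
    "sorted_wrt (\<lambda>u v. (u, v) \<in> ord) (order_list ord V)" by auto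
qed

text \<open>On the presented index list, passing to the inherited order is a mere filter, so the
  program never handles the order relation itself.\<close>

lemma order_list_remove:
  assumes "linear_order_on V ord" and "finite V"
  shows "order_list (Restr ord (V - {v})) (V - {v}) = filter (\<lambda>x. x \<noteq> v) (order_list ord V)"
proof (rule order_list_eqI)
  show "linear_order_on (V - {v}) (Restr ord (V - {v}))"
    using assms(1) by (rule linear_order_on_Restr) auto
  have "sorted_wrt (\<lambda>u w. (u, w) \<in> ord) (filter (\<lambda>x. x \<noteq> v) (order_list ord V))"
    using order_list(3)[OF assms] by (rule sorted_wrt_filter)
  then show "sorted_wrt (\<lambda>u w. (u, w) \<in> Restr ord (V - {v}))
      (filter (\<lambda>x. x \<noteq> v) (order_list ord V))"
    by (rule sorted_wrt_mono_rel[rotated]) (use order_list(1)[OF assms] in auto)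
qed (use order_list(1,2)[OF assms] in auto)

text \<open>An element strictly between two neighbours would stand before or after both in the list,
  and antisymmetry excludes either. This inclusion makes the list pairs admissible in condition 3
  and bounds their sum by the red potential.\<close>

lemma zip_tl_subset_successor_rel:
  assumes "antisym ord" and "distinct ws" and sorted: "sorted_wrt (\<lambda>u v. (u, v) \<in> ord) ws"
  shows "set (zip ws (tl ws)) \<subseteq> successor_rel ord (set ws)"
proof (intro subsetI, clarify)
  fix a b assume "(a, b) \<in> set (zip ws (tl ws))"
  then obtain i where i: "Suc i < length ws" "a = ws ! i" "b = ws ! Suc i"
    by (auto simp: set_zip nth_tl less_diff_conv)
  have less: "(ws ! p, ws ! q) \<in> ord" if "p < q" "q < length ws" for p q
    using sorted_wrt_nth_less[OF sorted that] .
  have "False" if w: "w \<in> set ws" "w \<noteq> a" "w \<noteq> b" "(a, w) \<in> ord" "(w, b) \<in> ord" for w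
  proof -
    obtain j where j: "j < length ws" "w = ws ! j" using w(1) by (auto simp: in_set_conv_nth)
    then have "j \<noteq> i" "j \<noteq> Suc i" using w(2,3) i by auto
    then consider "j < i" | "Suc i < j" by linarith
    then show False
    proof cases
      case 1
      then have "(w, a) \<in> ord" using less i j by auto
      then show False using w antisymD[OF assms(1)] by blast
    next
      case 2
      then have "(b, w) \<in> ord" using less i j by auto
      then show False using w antisymD[OF assms(1)] by blast
    qed
  qed
  moreover have "a \<noteq> b" using i assms(2) by (simp add: nth_eq_iff_index_eq)
  ultimately show "(a, b) \<in> successor_rel ord (set ws)"
    using i less[of i "Suc i"] by (auto simp: successor_rel_def)
qed

text \<open>
  The bound on the potential is less than \<open>k + 1\<close> times the number \<open>|R| - 1\<close> of successor pairs, so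
  some pair contributes at most \<open>k\<close>.
\<close>

lemma small_red_potential_pair:
  assumes "linear_order_on (rows M) ord" and "finite (rows M)"
    and small: "small_red_potential r k M ord R"
    and ws: "ws = filter (\<lambda>v. v \<in> R) (order_list ord (rows M))"
  obtains a b where "(a, b) \<in> set (zip ws (tl ws))" and "pair_red r M a b \<le> k"
proof -
  have R: "R \<subseteq> rows M" "int (red_potential r M ord R) \<le> (int k + 1) * (int (card R) - 1) - 1"
    using small by (auto simp: small_red_potential_def)
  have wsR: "set ws = R" "distinct ws" "sorted_wrt (\<lambda>u v. (u, v) \<in> ord) ws"
    using order_list[OF assms(1,2)] R(1) by (auto simp: ws intro: sorted_wrt_filter)
  have antisym: "antisym ord" using assms(1) by (simp add: order_on_defs)
  let ?Z = "set (zip ws (tl ws))"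
  have sub: "?Z \<subseteq> successor_rel ord R"
    using zip_tl_subset_successor_rel[OF antisym wsR(2,3)] wsR(1) by simp
  have card: "card ?Z = card R - 1"
    using wsR distinct_zipI1[of ws "tl ws"] by (auto simp: distinct_card simp flip: wsR(1))
  have "finite R" using R(1) assms(2) by (rule finite_subset)
  then have fin: "finite (successor_rel ord R)"
    by (intro finite_subset[of "successor_rel ord R" "R \<times> R"]) (auto simp: successor_rel_def)
  have "\<exists>(a, b)\<in>?Z. pair_red r M a b \<le> k"
  proof (rule ccontr)
    assume neg: "\<not> ?thesis"
    have "card ?Z * (k + 1) \<le> (\<Sum>(u, v)\<in>?Z. pair_red r M u v)"
      using neg by (intro sum_bounded_below[where 'a = nat, simplified]) (auto simp: not_le Suc_le_eq)
    also have "\<dots> \<le> red_potential r M ord R"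
      unfolding red_potential_def using fin sub by (intro sum_mono2) auto
    finally have "int ((card R - 1) * (k + 1)) \<le> (int k + 1) * (int (card R) - 1) - 1"
      using R(2) card by (metis (no_types, lifting) of_nat_le_iff order_trans)
    \<comment> \<open>For empty \<open>R\<close> the bound on the potential is negative, which no
      sum of naturals meets. This makes the truncated \<open>card R - 1\<close> agree with the
      integer difference.\<close>
    moreover have "card R \<noteq> 0"
      using R(2) by (intro notI) simp
    then obtain n where "card R = Suc n" by (cases "card R") auto
    ultimately show False by (simp add: algebra_simps)
  qed
  then show thesis using that by blast
qed

section \<open>One contraction round on instances, and existence of the contraction sequence\<close>

lemma instances_contract_pair:
  assumes I: "(k, l, M, ord) \<in> instances A r choice" and "r \<in> A" and big: "l < card (rows M)"
    and ws: "ws = filter (\<lambda>v. v \<in> choice k l M ord) (order_list ord (rows M))"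
    and ab: "(a, b) \<in> set (zip ws (tl ws))" "pair_red r M a b \<le> k"
  shows "(k, l, contract_pair r a b M, Restr ord (rows M - {b})) \<in> instances A r choice"
    and "a \<in> rows M" and "b \<in> rows M" and "a \<noteq> b" and "red_number r M \<le> l"
proof -
  have M: "k \<le> l" "symmetric_matrix A M" "linear_order_on (rows M) ord" "finite (rows M)"
    "red_potential_property_by (choice k l) r k l M ord"
    using I by (auto simp: instances_def symmetric_matrix_def)
  from M(5) big have step: "\<forall>u\<in>rows M. row_red r M u \<le> l"
    "small_red_potential r k M ord (choice k l M ord)"
    "\<And>u v. (u, v) \<in> successor_rel ord (choice k l M ord) \<Longrightarrow> pair_red r M u v \<le> k \<Longrightarrow>
       red_potential_property_by (choice k l) r k l (contract_pair r u v M) (Restr ord (rows M - {v}))"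
    by (cases; simp)+
  have "set ws = choice k l M ord"
    using order_list(1)[OF M(3,4)] step(2) by (auto simp: ws small_red_potential_def)
  moreover have "set (zip ws (tl ws)) \<subseteq> successor_rel ord (set ws)"
    using order_list[OF M(3,4)] M(3) unfolding ws
    by (intro zip_tl_subset_successor_rel) (auto simp: order_on_defs intro: sorted_wrt_filter)
  ultimately have succ: "(a, b) \<in> successor_rel ord (choice k l M ord)" using ab(1) by auto
  then show rows: "a \<in> rows M" "b \<in> rows M" "a \<noteq> b"
    using step(2) by (auto simp: successor_rel_def small_red_potential_def)
  show "red_number r M \<le> l" using M(2) step(1) by (rule red_number_le)
  \<comment> \<open>Staying among the instances for the same \<open>k\<close>, \<open>l\<close> and
    \<open>choice\<close> is what lets both the induction and the choice program go on.\<close>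
  show "(k, l, contract_pair r a b M, Restr ord (rows M - {b})) \<in> instances A r choice"
    using M step(3)[OF succ ab(2)] rows symmetric_matrix_contract_pair[OF M(2) \<open>r \<in> A\<close> rows]
      linear_order_on_Restr[OF M(3), of "rows M - {b}"]
    by (auto simp: instances_def)
qed

lemma instances_pair:
  assumes "(k, l, M, ord) \<in> instances A r choice" and "l < card (rows M)"
    and "ws = filter (\<lambda>v. v \<in> choice k l M ord) (order_list ord (rows M))"
  obtains a b where "(a, b) \<in> set (zip ws (tl ws))" and "pair_red r M a b \<le> k"
proof -
  have M: "linear_order_on (rows M) ord" "finite (rows M)"
    "red_potential_property_by (choice k l) r k l M ord"
    using assms(1) by (auto simp: instances_def symmetric_matrix_def)
  from M(3) assms(2) have "small_red_potential r k M ord (choice k l M ord)"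
    by cases simp_all
  from small_red_potential_pair[OF M(1,2) this assms(3)] that show thesis .
qed

lemma instances_order_list:
  assumes "(k, l, M, ord) \<in> instances A r choice"
  shows "set (order_list ord (rows M)) = rows M" and "distinct (order_list ord (rows M))"
    and "length (order_list ord (rows M)) = card (rows M)"
proof -
  have "linear_order_on (rows M) ord" "finite (rows M)"
    using assms by (auto simp: instances_def symmetric_matrix_def)
  from order_list[OF this]
  show "set (order_list ord (rows M)) = rows M" "distinct (order_list ord (rows M))"
    "length (order_list ord (rows M)) = card (rows M)"
    by (auto dest: distinct_card)
qed

lemma instances_contract_to:
  assumes I: "(k, l, M, ord) \<in> instances A r choice" and "r \<in> A" and "card (rows M) \<le> l"
    and vs: "vs = order_list ord (rows M)"
  shows "vs \<noteq> []" and "symmetric_d_contraction_sequence r l M (contract_to (hd vs) (tl vs))"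
proof -
  have M: "symmetric_matrix A M" "rows M \<noteq> {}"
    using I by (auto simp: instances_def symmetric_matrix_def)
  then show ne: "vs \<noteq> []" using instances_order_list(1)[OF I] vs by auto
  show "symmetric_d_contraction_sequence r l M (contract_to (hd vs) (tl vs))"
    using M(1) assms(2,3) ne instances_order_list[OF I, folded vs]
    by (intro contract_to_sequence[of A]) auto
qed

lemma instances_contraction_sequence:
  assumes "(k, l, M, ord) \<in> instances A r choice" and "r \<in> A"
  shows "\<exists>cs. symmetric_d_contraction_sequence r l M cs"
  using assms(1)
proof (induction "card (rows M)" arbitrary: M ord rule: less_induct)
  case less
  note I = less.prems
  have M: "cols M = rows M" "finite (rows M)"
    using I by (auto simp: instances_def symmetric_matrix_def)
  show ?case
  proof (cases "card (rows M) \<le> l")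
    case True
    then show ?thesis using instances_contract_to(2)[OF I assms(2)] by blast
  next
    case False
    then have big: "l < card (rows M)" by simp
    obtain a b where ab:
      "(a, b) \<in> set (zip (filter (\<lambda>v. v \<in> choice k l M ord) (order_list ord (rows M)))
         (tl (filter (\<lambda>v. v \<in> choice k l M ord) (order_list ord (rows M)))))"
      "pair_red r M a b \<le> k"
      using instances_pair[OF I big refl] by blast
    note step = instances_contract_pair[OF I assms(2) big refl ab]
    have "card (rows (contract_pair r a b M)) < card (rows M)"
      unfolding rows_contract_pair using M(2) step(3) by (rule card_Diff1_less)
    then obtain cs where "symmetric_d_contraction_sequence r l (contract_pair r a b M) cs"
      using less.hyps step(1) by blast
    then show ?thesis
      using symmetric_d_contraction_sequence_Cons[OF M(1) step(2-5)] by blast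
  qed
qed

section \<open>Polynomial-time programs\<close>

lemma poly_nat_mono: "poly b m \<le> poly b n" if "m \<le> n" for b :: "nat poly"
  using that by (induction b) (auto intro: mult_le_mono)

text \<open>An output is no larger than the time spent producing it, so the two time bounds compose.
  The intermediate outputs must encode elements of \<open>D'\<close>, since the second program is
  specified only there.\<close>

lemma poly_time_on_comp:
  assumes "poly_time_on D e S" and "poly_time_on D' e' S'"
    and sub: "\<And>x y. x \<in> D \<Longrightarrow> y \<in> S x \<Longrightarrow> \<exists>z\<in>D'. y = e' z \<and> S' z \<subseteq> U x"
  shows "poly_time_on D e U"
proof -
  from assms(1) obtain p b where
    p: "\<And>x. x \<in> D \<Longrightarrow> \<exists>t y. exec p (e x) t y \<and> t \<le> poly b (size (e x)) \<and> y \<in> S x"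
    unfolding poly_time_on_def by blast
  from assms(2) obtain q c where
    q: "\<And>x. x \<in> D' \<Longrightarrow> \<exists>t y. exec q (e' x) t y \<and> t \<le> poly c (size (e' x)) \<and> y \<in> S' x"
    unfolding poly_time_on_def by blast
  have "\<exists>t y. exec (Seq p q) (e x) t y \<and> t \<le> poly (1 + b + pcompose c b) (size (e x)) \<and> y \<in> U x"
    if x: "x \<in> D" for x
  proof -
    obtain s y where y: "exec p (e x) s y" "s \<le> poly b (size (e x))" "y \<in> S x"
      using p[OF x] by blast
    obtain z where z: "z \<in> D'" "y = e' z" "S' z \<subseteq> U x"
      using sub[OF x y(3)] by blast
    obtain t w where w: "exec q y t w" "t \<le> poly c (size y)" "w \<in> U x"
      using q[OF z(1)] z by blast
    have "poly c (size y) \<le> poly c (poly b (size (e x)))"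
      using exec_size[OF y(1)] y(2) by (intro poly_nat_mono) simp
    then have "1 + s + t \<le> poly (1 + b + pcompose c b) (size (e x))"
      using y w by (simp add: poly_pcompose)
    then show ?thesis
      using exec.Seq[OF y(1) w(1)] w(3) by blast
  qed
  then show ?thesis unfolding poly_time_on_def by blast
qed

lemma poly_time_on_Pair:
  assumes "poly_time_on D e S" and "poly_time_on D e S'"
  shows "poly_time_on D e (\<lambda>x. {Node y z | y z. y \<in> S x \<and> z \<in> S' x})"
proof -
  from assms(1) obtain p b where
    p: "\<And>x. x \<in> D \<Longrightarrow> \<exists>t y. exec p (e x) t y \<and> t \<le> poly b (size (e x)) \<and> y \<in> S x"
    unfolding poly_time_on_def by blast
  from assms(2) obtain q c where
    q: "\<And>x. x \<in> D \<Longrightarrow> \<exists>t y. exec q (e x) t y \<and> t \<le> poly c (size (e x)) \<and> y \<in> S' x"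
    unfolding poly_time_on_def by blast
  have "\<exists>t w. exec (Pair p q) (e x) t w \<and> t \<le> poly (1 + b + c) (size (e x)) \<and>
      w \<in> {Node y z | y z. y \<in> S x \<and> z \<in> S' x}" if x: "x \<in> D" for x
  proof -
    obtain s y where y: "exec p (e x) s y" "s \<le> poly b (size (e x))" "y \<in> S x"
      using p[OF x] by blast
    obtain t z where z: "exec q (e x) t z" "t \<le> poly c (size (e x))" "z \<in> S' x"
      using q[OF x] by blast
    have "1 + s + t \<le> poly (1 + b + c) (size (e x))" using y z by simp
    then show ?thesis using exec.Pair[OF y(1) z(1)] y(3) z(3) by blast
  qed
  then show ?thesis unfolding poly_time_on_def by blast
qed

text \<open>There are \<open>n + 1\<close> tests and \<open>n\<close> bodies, each within
  \<open>T\<close>. As \<open>J\<close> is a relation, the body may move to any admissible successor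
  state.\<close>

lemma exec_While_le:
  assumes "\<And>i s. J (Suc i) s \<Longrightarrow> \<exists>t y. exec p (e s) t y \<and> t \<le> T \<and> y \<noteq> Leaf"
    and "\<And>i s. J (Suc i) s \<Longrightarrow> \<exists>t s'. exec q (e s) t (e s') \<and> t \<le> T \<and> J i s'"
    and "\<And>s. J 0 s \<Longrightarrow> \<exists>t. exec p (e s) t Leaf \<and> t \<le> T"
    and "J n s"
  shows "\<exists>t s'. exec (While p q) (e s) t (e s') \<and> t \<le> (n + 1) * (2 * T + 1) \<and> J 0 s'"
  using assms(4)
proof (induction n arbitrary: s)
  case 0
  obtain t where t: "exec p (e s) t Leaf" "t \<le> T" using assms(3)[OF 0] by blast
  then have "1 + t \<le> (0 + 1) * (2 * T + 1)" by simp
  then show ?case using exec.While_False[OF t(1)] 0 by blast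
next
  case (Suc n)
  obtain t y where y: "exec p (e s) t y" "t \<le> T" "y \<noteq> Leaf"
    using assms(1)[OF Suc.prems] by blast
  obtain t' s' where s': "exec q (e s) t' (e s')" "t' \<le> T" "J n s'"
    using assms(2)[OF Suc.prems] by blast
  obtain u s'' where
    s'': "exec (While p q) (e s') u (e s'')" "u \<le> (n + 1) * (2 * T + 1)" "J 0 s''"
    using Suc.IH[OF s'(3)] by blast
  have "1 + t + t' + u \<le> (Suc n + 1) * (2 * T + 1)" using y s' s'' by simp
  then show ?case
    using exec.While_True[OF y(1,3) s'(1) s''(1)] s''(3) by blast
qed

text \<open>In \<open>J x i s\<close>, the number \<open>i\<close> counts the iterations that are left from state \<open>s\<close> on input \<open>x\<close>.\<close>

lemma poly_time_on_while:
  fixes e :: "'s \<Rightarrow> tree" and n :: "'i \<Rightarrow> nat"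
  assumes "poly_time_on S e (\<lambda>s. {c s})"
    and "poly_time_on {s \<in> S. c s \<noteq> Leaf} e B"
    and start: "\<And>x. x \<in> D \<Longrightarrow> \<exists>s. enc x = e s \<and> J x (n x) s"
    and iter: "\<And>x. x \<in> D \<Longrightarrow> n x \<le> poly N (size (enc x))"
    and size: "\<And>x i s. x \<in> D \<Longrightarrow> J x i s \<Longrightarrow> s \<in> S \<and> size (e s) \<le> poly b (size (enc x))"
    and step: "\<And>x i s y. x \<in> D \<Longrightarrow> J x (Suc i) s \<Longrightarrow> y \<in> B s \<Longrightarrow> \<exists>s'. y = e s' \<and> J x i s'"
    and run: "\<And>x i s. x \<in> D \<Longrightarrow> J x (Suc i) s \<Longrightarrow> c s \<noteq> Leaf"
    and stop: "\<And>x s. x \<in> D \<Longrightarrow> J x 0 s \<Longrightarrow> c s = Leaf"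
  shows "poly_time_on D enc (\<lambda>x. {e s | s. J x 0 s})"
proof -
  from assms(1) obtain p c1 where
    p: "\<And>s. s \<in> S \<Longrightarrow> \<exists>t. exec p (e s) t (c s) \<and> t \<le> poly c1 (size (e s))"
    unfolding poly_time_on_def by blast
  from assms(2) obtain q c2 where
    q: "\<And>s. s \<in> S \<Longrightarrow> c s \<noteq> Leaf \<Longrightarrow>
      \<exists>t y. exec q (e s) t y \<and> t \<le> poly c2 (size (e s)) \<and> y \<in> B s"
    unfolding poly_time_on_def by blast
  \<comment> \<open>The bound of \<open>exec_While_le\<close>, with \<open>N\<close> for the number
    of rounds and both time bounds evaluated at the largest state size \<open>b\<close>.\<close>
  let ?c = "(N + 1) * (2 * (pcompose c1 b + pcompose c2 b) + 1)"
  have "\<exists>t y. exec (While p q) (enc x) t y \<and> t \<le> poly ?c (size (enc x)) \<and> y \<in> {e s | s. J x 0 s}"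
    if x: "x \<in> D" for x
  proof -
    let ?m = "size (enc x)"
    define T where "T = poly c1 (poly b ?m) + poly c2 (poly b ?m)"
    have le: "poly c1 (size (e s)) \<le> T" "poly c2 (size (e s)) \<le> T" if "J x i s" for i s
      using size[OF x that] poly_nat_mono[of "size (e s)" "poly b ?m" c1]
        poly_nat_mono[of "size (e s)" "poly b ?m" c2]
      by (auto simp: T_def)
    obtain s where s: "enc x = e s" "J x (n x) s" using start[OF x] by blast
    have "\<exists>t s'. exec (While p q) (e s) t (e s') \<and> t \<le> (n x + 1) * (2 * T + 1) \<and> J x 0 s'"
    proof (rule exec_While_le)
      show "\<exists>t y. exec p (e s) t y \<and> t \<le> T \<and> y \<noteq> Leaf" if "J x (Suc i) s" for i s
        using p size[OF x that] le(1)[OF that] run[OF x that] le_trans by blast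
      show "\<exists>t s'. exec q (e s) t (e s') \<and> t \<le> T \<and> J x i s'" if J: "J x (Suc i) s" for i s
      proof -
        obtain t y where y: "exec q (e s) t y" "t \<le> poly c2 (size (e s))" "y \<in> B s"
          using q size[OF x J] run[OF x J] by blast
        then show ?thesis using step[OF x J y(3)] le(2)[OF J] le_trans by blast
      qed
      show "\<exists>t. exec p (e s) t Leaf \<and> t \<le> T" if J: "J x 0 s" for s
        using p[of s] size[OF x J] le(1)[OF J] stop[OF x J] le_trans by fastforce
    qed (fact s(2))
    then obtain t s' where
      s': "exec (While p q) (e s) t (e s')" "t \<le> (n x + 1) * (2 * T + 1)" "J x 0 s'" by blast
    have "t \<le> poly ?c ?m"
    proof -
      have "(n x + 1) * (2 * T + 1) \<le> (poly N ?m + 1) * (2 * T + 1)"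
        using iter[OF x] by (intro mult_le_mono) auto
      also have "\<dots> = poly ?c ?m"
        by (simp add: T_def poly_pcompose)
      finally show ?thesis using s'(2) by simp
    qed
    then show ?thesis using s' s(1) by auto
  qed
  then show ?thesis unfolding poly_time_on_def by blast
qed

section \<open>Total polynomial-time functions on trees and their closure properties\<close>

definition polytime :: "(tree \<Rightarrow> tree) \<Rightarrow> bool" where
  "polytime f \<longleftrightarrow> poly_time_on UNIV (\<lambda>x. x) (\<lambda>x. {f x})"

named_theorems polytime_intros

fun lft :: "tree \<Rightarrow> tree" where
  "lft Leaf = Leaf"
| "lft (Node a b) = a"

fun rgt :: "tree \<Rightarrow> tree" where
  "rgt Leaf = Leaf"
| "rgt (Node a b) = b"

definition truth :: "bool \<Rightarrow> tree" where
  "truth P = (if P then Node Leaf Leaf else Leaf)"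

lemma truth_eq_Leaf [simp]: "truth P = Leaf \<longleftrightarrow> \<not> P"
  by (simp add: truth_def)

lemma polytimeI:
  fixes b :: "nat poly"
  assumes "\<And>x. \<exists>t. exec p x t (f x) \<and> t \<le> poly b (size x)"
  shows "polytime f"
  unfolding polytime_def poly_time_on_def
  by (rule exI[of _ p], rule exI[of _ b]) (use assms in auto)

lemma polytime_size:
  assumes "polytime f"
  obtains b :: "nat poly" where "\<And>x. size (f x) \<le> poly b (size x)"
proof -
  from assms obtain p b where "\<And>x. \<exists>t. exec p x t (f x) \<and> t \<le> poly b (size x)"
    unfolding polytime_def poly_time_on_def by auto
  then have "size (f x) \<le> poly b (size x)" for x
    by (meson exec_size le_trans)
  then show thesis by (rule that)
qed

lemma poly_time_on_image:
  assumes "poly_time_on D e S" and "polytime f"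
    and "\<And>x y. x \<in> D \<Longrightarrow> y \<in> S x \<Longrightarrow> f y \<in> U x"
  shows "poly_time_on D e U"
  using assms(3) by (intro poly_time_on_comp[OF assms(1) assms(2)[unfolded polytime_def]]) auto

lemma poly_time_on_polytime:
  assumes "polytime f" shows "poly_time_on D e (\<lambda>x. {f (e x)})"
  using assms unfolding polytime_def poly_time_on_def by blast

lemma polytime_comp: "polytime f \<Longrightarrow> polytime g \<Longrightarrow> polytime (\<lambda>x. f (g x))"
  unfolding polytime_def by (erule poly_time_on_comp) auto

lemma polytime_id [polytime_intros]: "polytime (\<lambda>x. x)"
  by (rule polytimeI[of Ident _ "[:1, 1:]"]) (auto intro!: exec.Ident)

lemma polytime_const [polytime_intros]: "polytime (\<lambda>x. c)"
  by (rule polytimeI[of "Const c" _ "[:1 + size c, 1:]"]) (auto intro!: exI exec.Const)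

lemma polytime_lft [polytime_intros]:
  assumes "polytime f" shows "polytime (\<lambda>x. lft (f x))"
proof -
  have "\<exists>t. exec Left x t (lft x) \<and> t \<le> poly [:1, 1:] (size x)" for x
    by (cases x) (use exec.Left exec.Left_Leaf in \<open>fastforce+\<close>)
  then show ?thesis by (rule polytime_comp[OF polytimeI assms])
qed

lemma polytime_rgt [polytime_intros]:
  assumes "polytime f" shows "polytime (\<lambda>x. rgt (f x))"
proof -
  have "\<exists>t. exec Right x t (rgt x) \<and> t \<le> poly [:1, 1:] (size x)" for x
    by (cases x) (use exec.Right exec.Right_Leaf in \<open>fastforce+\<close>)
  then show ?thesis by (rule polytime_comp[OF polytimeI assms])
qed

lemma polytime_Node [polytime_intros]:
  "polytime f \<Longrightarrow> polytime g \<Longrightarrow> polytime (\<lambda>x. Node (f x) (g x))"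
  unfolding polytime_def by (drule (1) poly_time_on_Pair) simp

lemma polytime_eq [polytime_intros]:
  assumes "polytime f" "polytime g" shows "polytime (\<lambda>x. truth (f x = g x))"
proof -
  let ?h = "\<lambda>x. truth (x \<noteq> Leaf \<and> lft x = rgt x)"
  have "\<exists>t. exec Equal x t (?h x) \<and> t \<le> poly [:1, 1:] (size x)" for x
    by (cases x) (use exec.Equal exec.Equal_Leaf in \<open>fastforce simp: truth_def\<close>)+
  then have "polytime ?h" by (rule polytimeI)
  from polytime_comp[OF this polytime_Node[OF assms]] show ?thesis by simp
qed

text \<open>A loop serves as a conditional: \<open>lft s\<close> is the guard, and the body resets
  it to \<open>Leaf\<close>, so that the body runs at most once.\<close>

lemma polytime_when:
  assumes "polytime f"
  shows "polytime (\<lambda>s. if lft s = Leaf then s else Node Leaf (f (rgt s)))"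
proof -
  let ?f = "\<lambda>s. Node Leaf (f (rgt s))"
  define h where "h s = (if lft s = Leaf then s else ?f s)" for s
  define n where "n s = (if lft s = Leaf then 0 else 1 :: nat)" for s
  define J where "J x i s \<longleftrightarrow> i = n s \<and> (s = x \<or> s = h x)" for x i s
  have f: "polytime ?f" by (intro polytime_intros polytime_comp[OF assms])
  then obtain b where b: "\<And>x. size (?f x) \<le> poly b (size x)" by (rule polytime_size) blast
  have "poly_time_on UNIV (\<lambda>s. s) (\<lambda>x. {s | s. J x 0 s})"
  proof (rule poly_time_on_while[where S = UNIV and c = lft and B = "\<lambda>s. {?f s}" and n = n
        and N = 1 and b = "[:0, 1:] + b"])
    show "poly_time_on UNIV (\<lambda>s. s) (\<lambda>s. {lft s})"
      by (intro poly_time_on_polytime polytime_intros)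
    show "poly_time_on {s \<in> UNIV. lft s \<noteq> Leaf} (\<lambda>s. s) (\<lambda>s. {?f s})"
      using f by (rule poly_time_on_polytime)
    show "s \<in> UNIV \<and> size s \<le> poly ([:0, 1:] + b) (size x)" if "J x i s" for x i s
      using that b[of x] by (auto simp: J_def h_def split: if_splits)
  qed (auto simp: J_def n_def h_def split: if_splits)
  moreover have "{s | s. J x 0 s} = {h x}" for x
    by (auto simp: J_def n_def h_def)
  ultimately show ?thesis by (simp add: polytime_def h_def)
qed

lemma polytime_if [polytime_intros]:
  assumes P: "polytime (\<lambda>x. truth (P x))" and f: "polytime f" and g: "polytime g"
  shows "polytime (\<lambda>x. if P x then f x else g x)"
proof -
  define w where "w f s = (if lft s = Leaf then s else Node Leaf (f (rgt s)))" for f s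
  \<comment> \<open>Two guarded blocks make an if-then-else. The first overwrites \<open>x\<close>,
    so it also leaves a marker; the guard of the second block is the absence of that marker.\<close>
  let ?f = "\<lambda>y. Node (Node Leaf Leaf) (f (rgt y))"
  have "polytime (w ?f)" "polytime (w g)"
    unfolding w_def by (intro polytime_when polytime_intros polytime_comp[OF f] g)+
  note w = this[THEN polytime_comp]
  let ?t = "\<lambda>x. rgt (w ?f (Node (truth (P x)) (Node Leaf x)))"
  have "polytime (\<lambda>x. rgt (w g (Node (truth (lft (?t x) = Leaf)) (rgt (?t x)))))"
    using P by (intro polytime_intros w)
  also have "(\<lambda>x. rgt (w g (Node (truth (lft (?t x) = Leaf)) (rgt (?t x))))) =
      (\<lambda>x. if P x then f x else g x)"
    by (auto simp: w_def)
  finally show ?thesis .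
qed

lemma polytime_not [polytime_intros]:
  "polytime (\<lambda>x. truth (P x)) \<Longrightarrow> polytime (\<lambda>x. truth (\<not> P x))"
  by (drule polytime_eq[OF _ polytime_const[of Leaf]]) simp

lemma polytime_conj [polytime_intros]:
  assumes "polytime (\<lambda>x. truth (P x))" and "polytime (\<lambda>x. truth (Q x))"
  shows "polytime (\<lambda>x. truth (P x \<and> Q x))"
proof -
  have "polytime (\<lambda>x. if P x then truth (Q x) else Leaf)"
    using assms by (intro polytime_intros)
  also have "(\<lambda>x. if P x then truth (Q x) else Leaf) = (\<lambda>x. truth (P x \<and> Q x))"
    by (auto simp: truth_def)
  finally show ?thesis .
qed

section \<open>Recursion over lists\<close>

text \<open>Every tree is read as a list, whose elements are the left children on the right spine.\<close>

fun tlength :: "tree \<Rightarrow> nat" where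
  "tlength Leaf = 0"
| "tlength (Node e xs) = Suc (tlength xs)"

fun tfoldl :: "(tree \<Rightarrow> tree \<Rightarrow> tree) \<Rightarrow> tree \<Rightarrow> tree \<Rightarrow> tree" where
  "tfoldl f Leaf a = a"
| "tfoldl f (Node e xs) a = tfoldl f xs (f e a)"

fun tfoldr :: "(tree \<Rightarrow> tree \<Rightarrow> tree) \<Rightarrow> tree \<Rightarrow> tree \<Rightarrow> tree" where
  "tfoldr f Leaf a = a"
| "tfoldr f (Node e xs) a = f e (tfoldr f xs a)"

lemma tlength_le_size: "tlength xs \<le> size xs"
  by (induction xs) auto

text \<open>\<open>tfoldl Node xs ys\<close> pushes the elements of \<open>xs\<close> onto
  \<open>ys\<close> in reverse. A loop consumes a list from the front, so a right fold runs as a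
  left fold over the reversed list.\<close>

lemma tfoldl_tfoldl_Node: "tfoldl f (tfoldl Node xs ys) a = tfoldl f ys (tfoldr f xs a)"
  by (induction xs arbitrary: ys) auto

lemma tfoldr_eq_tfoldl: "tfoldr f xs a = tfoldl f (tfoldl Node xs Leaf) a"
  by (simp add: tfoldl_tfoldl_Node)

text \<open>
  The step function may enlarge the accumulator only additively; otherwise its size could grow
  exponentially.
\<close>

lemma polytime_tfoldl:
  fixes c :: "nat poly"
  assumes f: "polytime (\<lambda>z. f (lft z) (lft (rgt z)) (rgt (rgt z)))"
    and l: "polytime l" and a: "polytime a"
    and size: "\<And>x e s. size (f x e s) \<le> size s + poly c (size x + size e)"
  shows "polytime (\<lambda>x. tfoldl (f x) (l x) (a x))"
proof -
  \<comment> \<open>The state keeps \<open>x\<close>, since the step function depends on it. The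
    last conjunct is a budget: each remaining element reserves the growth it may cause, so the
    accumulator is bounded at all times.\<close>
  define J where "J z i s \<longleftrightarrow> (case z of (x, xs, a) \<Rightarrow> \<exists>ys b. s = Node x (Node ys b) \<and>
      tlength ys = i \<and> tfoldl (f x) ys b = tfoldl (f x) xs a \<and> size ys \<le> size xs \<and>
      size b + i * poly c (size x + size xs) \<le>
        size a + tlength xs * poly c (size x + size xs))" for z i s
  let ?enc = "\<lambda>(x, xs, a). Node x (Node xs a)"
  let ?f = "\<lambda>s. Node (lft s) (Node (rgt (lft (rgt s)))
      (f (lft s) (lft (lft (rgt s))) (rgt (rgt s))))"
  have f': "polytime (\<lambda>x. f (p x) (q x) (r x))" if "polytime p" "polytime q" "polytime r" for p q r
    using polytime_comp[OF f, of "\<lambda>x. Node (p x) (Node (q x) (r x))"] that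
    by (simp add: polytime_Node)
  have pf: "polytime ?f" by (intro polytime_intros f')
  have "poly_time_on UNIV ?enc (\<lambda>z. {s | s. J z 0 s})"
  proof (rule poly_time_on_while[where S = UNIV and c = "\<lambda>s. lft (rgt s)" and
        B = "\<lambda>s. {?f s}" and n = "\<lambda>(x, xs, a). tlength xs" and N = "[:0, 1:]" and
        b = "[:2, 1:] + [:0, 1:] + [:0, 1:] * c"])
    show "poly_time_on UNIV (\<lambda>s. s) (\<lambda>s. {lft (rgt s)})"
      by (intro poly_time_on_polytime polytime_intros)
    show "poly_time_on {s \<in> UNIV. lft (rgt s) \<noteq> Leaf} (\<lambda>s. s) (\<lambda>s. {?f s})"
      using pf by (rule poly_time_on_polytime)
  next
    fix z show "\<exists>s. ?enc z = s \<and> J z ((\<lambda>(x, xs, a). tlength xs) z) s"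
      by (auto simp: J_def split: prod.splits)
  next
    fix z show "(\<lambda>(x, xs, a). tlength xs) z \<le> poly [:0, 1:] (size (?enc z))"
      using tlength_le_size[of "fst (snd z)"] by (auto split: prod.splits)
  next
    fix z i s assume J: "J z i s"
    obtain x xs a where z: "z = (x, xs, a)" by (cases z)
    obtain ys b where s: "s = Node x (Node ys b)" "size ys \<le> size xs"
      "size b + i * poly c (size x + size xs) \<le> size a + tlength xs * poly c (size x + size xs)"
      using J by (auto simp: J_def z)
    let ?m = "size (?enc z)"
    have "size b \<le> size a + tlength xs * poly c (size x + size xs)" using s(3) by linarith
    also have "\<dots> \<le> size a + ?m * poly c ?m"
      using tlength_le_size[of xs]
      by (intro add_left_mono mult_le_mono poly_nat_mono) (auto simp: z)
    finally show "s \<in> UNIV \<and> size s \<le> poly ([:2, 1:] + [:0, 1:] + [:0, 1:] * c) ?m"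
      using s(1,2) by (simp add: z)
  next
    fix z i s y assume J: "J z (Suc i) s" and y: "y \<in> {?f s}"
    obtain x xs a where z: "z = (x, xs, a)" by (cases z)
    obtain ys b where s: "s = Node x (Node ys b)" "tlength ys = Suc i" "size ys \<le> size xs"
      "tfoldl (f x) ys b = tfoldl (f x) xs a"
      "size b + Suc i * poly c (size x + size xs) \<le> size a + tlength xs * poly c (size x + size xs)"
      using J by (auto simp: J_def z)
    obtain e ys' where ys: "ys = Node e ys'" using s(2) by (cases ys) auto
    have "size (f x e b) \<le> size b + poly c (size x + size e)" by (rule size)
    also have "\<dots> \<le> size b + poly c (size x + size xs)"
      using s(3) by (intro add_left_mono poly_nat_mono) (simp add: ys)
    finally have "J z i (?f s)"
      using s by (simp add: J_def z ys)
    then show "\<exists>s'. y = s' \<and> J z i s'" using y by auto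
  next
    fix z i s assume "J z (Suc i) s"
    then show "lft (rgt s) \<noteq> Leaf" by (auto simp: J_def split: prod.splits)
  next
    fix z s assume "J z 0 s"
    then show "lft (rgt s) = Leaf"
      by (auto simp: J_def split: prod.splits) (metis tlength.elims nat.distinct(1))
  qed
  note loop = this
  have "polytime (\<lambda>x. Node x (Node (l x) (a x)))" using l a by (intro polytime_intros)
  then have init: "poly_time_on UNIV (\<lambda>x. x) (\<lambda>x. {Node x (Node (l x) (a x))})"
    by (rule poly_time_on_polytime)
  have "poly_time_on UNIV (\<lambda>x. x) (\<lambda>x. {s. J (x, l x, a x) 0 s})"
    by (rule poly_time_on_comp[OF init loop]) auto
  then have "poly_time_on UNIV (\<lambda>x. x) (\<lambda>x. {tfoldl (f x) (l x) (a x)})"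
  proof (rule poly_time_on_image)
    show "polytime (\<lambda>s. rgt (rgt s))" by (intro polytime_intros)
    show "rgt (rgt s) \<in> {tfoldl (f x) (l x) (a x)}" if "s \<in> {s. J (x, l x, a x) 0 s}" for x s
      using that by (auto simp: J_def elim: tlength.elims)
  qed
  then show ?thesis unfolding polytime_def .
qed

lemma polytime_tfoldr:
  fixes c :: "nat poly"
  assumes f: "polytime (\<lambda>z. f (lft z) (lft (rgt z)) (rgt (rgt z)))"
    and l: "polytime l" and a: "polytime a"
    and size: "\<And>x e s. size (f x e s) \<le> size s + poly c (size x + size e)"
  shows "polytime (\<lambda>x. tfoldr (f x) (l x) (a x))"
proof -
  have rev: "polytime (\<lambda>x. tfoldl ((\<lambda>x. Node) x) (l x) Leaf)"
    by (rule polytime_tfoldl[where c = "[:1, 1:]"]) (auto intro!: polytime_intros l)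
  show ?thesis
    unfolding tfoldr_eq_tfoldl by (rule polytime_tfoldl[OF f rev a size])
qed

definition tmap :: "(tree \<Rightarrow> tree) \<Rightarrow> tree \<Rightarrow> tree" where
  "tmap f xs = tfoldr (\<lambda>e. Node (f e)) xs Leaf"

definition tfilter :: "(tree \<Rightarrow> bool) \<Rightarrow> tree \<Rightarrow> tree" where
  "tfilter P xs = tfoldr (\<lambda>e ys. if P e then Node e ys else ys) xs Leaf"

definition tmember :: "tree \<Rightarrow> tree \<Rightarrow> bool" where
  "tmember x xs \<longleftrightarrow> tfoldr (\<lambda>e s. if e = x then Node Leaf Leaf else s) xs Leaf \<noteq> Leaf"

definition tlookup :: "tree \<Rightarrow> tree \<Rightarrow> tree" where
  "tlookup xs x = tfoldr (\<lambda>e s. if lft e = x then rgt e else s) xs Leaf"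

definition tappend :: "tree \<Rightarrow> tree \<Rightarrow> tree" where
  "tappend xs ys = tfoldr Node xs ys"

text \<open>The second list is reversed first, because \<open>tfoldr\<close> meets the last element of \<open>xs\<close> first.\<close>

definition tzip :: "tree \<Rightarrow> tree \<Rightarrow> tree" where
  "tzip xs ys = rgt (tfoldr (\<lambda>e s. Node (rgt (lft s)) (Node (Node e (lft (lft s))) (rgt s)))
     xs (Node (tfoldl Node ys Leaf) Leaf))"

text \<open>
  At most \<open>k\<close> elements satisfy \<open>P\<close>, where \<open>k\<close> is in unary: one unit of \<open>k + 1\<close> is removed for each
  of them.
\<close>

definition tat_most :: "(tree \<Rightarrow> bool) \<Rightarrow> tree \<Rightarrow> tree \<Rightarrow> bool" where
  "tat_most P xs k \<longleftrightarrow> tfoldr (\<lambda>e s. if P e then rgt s else s) xs (Node Leaf k) \<noteq> Leaf"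

text \<open>
  Searches for two consecutive elements satisfying \<open>P\<close>. The accumulator consists of the element
  visited last (preceded by \<open>Leaf\<close>, to tell it from no element at all) and the pair found so far.
\<close>

definition tsearch :: "(tree \<Rightarrow> tree \<Rightarrow> bool) \<Rightarrow> tree \<Rightarrow> tree" where
  "tsearch P xs = rgt (tfoldr (\<lambda>e s. Node (Node Leaf e)
     (if lft s \<noteq> Leaf \<and> P e (rgt (lft s)) then Node e (rgt (lft s)) else rgt s)) xs Leaf)"

lemma size_lft_le: "size (lft x) \<le> size x" and size_rgt_le: "size (rgt x) \<le> size x"
  by (cases x; simp)+

lemma polytime_tmap [polytime_intros]:
  assumes f: "polytime (\<lambda>z. f (lft z) (rgt z))" and l: "polytime l"
  shows "polytime (\<lambda>x. tmap (f x) (l x))"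
proof -
  obtain b :: "nat poly" where b: "\<And>z. size (f (lft z) (rgt z)) \<le> poly b (size z)"
    using polytime_size[OF f] by metis
  have f': "polytime (\<lambda>x. f (p x) (q x))" if "polytime p" "polytime q" for p q
    using polytime_comp[OF f polytime_Node[OF that]] by simp
  show ?thesis unfolding tmap_def
  \<comment> \<open>One new \<open>Node\<close>, plus the output of \<open>f\<close> on
    \<open>Node x e\<close>, whose size is given by \<open>[:1, 1:]\<close> at
    \<open>size x + size e\<close>.\<close>
  proof (rule polytime_tfoldr[where c = "1 + pcompose b [:1, 1:]"])
    fix x e s
    show "size (Node (f x e) s) \<le> size s + poly (1 + pcompose b [:1, 1:]) (size x + size e)"
      using b[of "Node x e"] by (simp add: poly_pcompose)
  qed (intro polytime_intros f' l)+
qed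

lemma polytime_tfilter [polytime_intros]:
  assumes P: "polytime (\<lambda>z. truth (P (lft z) (rgt z)))" and l: "polytime l"
  shows "polytime (\<lambda>x. tfilter (P x) (l x))"
proof -
  have P': "polytime (\<lambda>x. truth (P (p x) (q x)))" if "polytime p" "polytime q" for p q
    using polytime_comp[OF P polytime_Node[OF that]] by simp
  show ?thesis unfolding tfilter_def
    by (rule polytime_tfoldr[where c = "[:1, 1:]"]) (intro polytime_intros P' l | simp)+
qed

lemma polytime_tmember [polytime_intros]:
  assumes a: "polytime a" and l: "polytime l"
  shows "polytime (\<lambda>x. truth (tmember (a x) (l x)))"
proof -
  have "polytime (\<lambda>x. tfoldr (\<lambda>e s. if e = a x then Node Leaf Leaf else s) (l x) Leaf)"
    by (rule polytime_tfoldr[where c = 1])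
      (intro polytime_intros polytime_comp[OF a] l | simp)+
  then show ?thesis unfolding tmember_def by (intro polytime_intros)
qed

lemma polytime_tlookup [polytime_intros]:
  assumes l: "polytime l" and a: "polytime a"
  shows "polytime (\<lambda>x. tlookup (l x) (a x))"
  unfolding tlookup_def
  by (rule polytime_tfoldr[where c = "[:0, 1:]"])
    (intro polytime_intros polytime_comp[OF a] l | simp add: size_rgt_le trans_le_add2)+

lemma polytime_tappend [polytime_intros]:
  assumes "polytime l" and "polytime m"
  shows "polytime (\<lambda>x. tappend (l x) (m x))"
  unfolding tappend_def
  by (rule polytime_tfoldr[where c = "[:1, 1:]" and f = "\<lambda>x. Node"])
    (intro polytime_intros assms | simp)+

lemma polytime_tzip [polytime_intros]:
  assumes l: "polytime l" and m: "polytime m"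
  shows "polytime (\<lambda>x. tzip (l x) (m x))"
proof -
  have rev: "polytime (\<lambda>x. tfoldl ((\<lambda>x. Node) x) (m x) Leaf)"
    by (rule polytime_tfoldl[where c = "[:1, 1:]"]) (intro polytime_intros m | simp)+
  \<comment> \<open>Only three nodes and \<open>e\<close> are new; the rest is rearranged from
    \<open>s\<close>.\<close>
  have size: "size (Node (rgt (lft s)) (Node (Node e (lft (lft s))) (rgt s))) \<le>
      size s + poly [:3, 1:] (size x + size e)" for x e s :: tree
    by (cases s; cases "lft s") auto
  show ?thesis unfolding tzip_def
    by (intro polytime_intros polytime_tfoldr[where c = "[:3, 1:]"] l rev size)
qed

lemma polytime_tat_most [polytime_intros]:
  assumes P: "polytime (\<lambda>z. truth (P (lft z) (rgt z)))" and l: "polytime l" and k: "polytime k"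
  shows "polytime (\<lambda>x. truth (tat_most (P x) (l x) (k x)))"
proof -
  have P': "polytime (\<lambda>x. truth (P (p x) (q x)))" if "polytime p" "polytime q" for p q
    using polytime_comp[OF P polytime_Node[OF that]] by simp
  have "polytime (\<lambda>x. tfoldr (\<lambda>e s. if P x e then rgt s else s) (l x) (Node Leaf (k x)))"
    by (rule polytime_tfoldr[where c = 0])
      (intro polytime_intros P' l k | simp add: size_rgt_le)+
  then show ?thesis unfolding tat_most_def by (intro polytime_intros)
qed

lemma polytime_tsearch [polytime_intros]:
  assumes P: "polytime (\<lambda>z. truth (P (lft z) (lft (rgt z)) (rgt (rgt z))))" and l: "polytime l"
  shows "polytime (\<lambda>x. tsearch (P x) (l x))"
proof -
  have P': "polytime (\<lambda>x. truth (P (p x) (q x) (r x)))"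
    if "polytime p" "polytime q" "polytime r" for p q r
    using polytime_comp[OF P polytime_Node[OF that(1) polytime_Node[OF that(2,3)]]] by simp
  \<comment> \<open>\<open>e\<close> may be stored twice. The element visited before moves from the
    left part into the pair, replacing the old pair, so nothing of \<open>s\<close> is
    duplicated.\<close>
  have size: "size (Node (Node Leaf e)
      (if lft s \<noteq> Leaf \<and> P x e (rgt (lft s)) then Node e (rgt (lft s)) else rgt s)) \<le>
      size s + poly [:3, 2:] (size x + size e)" for x e s :: tree
    by (cases s; cases "lft s") auto
  show ?thesis unfolding tsearch_def
    by (intro polytime_intros polytime_tfoldr[where c = "[:3, 2:]"] P' l size)
qed

section \<open>Tree operations on encoded lists\<close>

lemma tfoldr_enc_list [simp]: "tfoldr f (enc_list g xs) a = foldr (\<lambda>x. f (g x)) xs a"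
  by (induction xs) auto

lemma tmap_enc_list [simp]: "tmap f (enc_list g xs) = enc_list (\<lambda>x. f (g x)) xs"
  unfolding tmap_def by (induction xs) auto

lemma tfilter_enc_list [simp]: "tfilter P (enc_list g xs) = enc_list g (filter (\<lambda>x. P (g x)) xs)"
  unfolding tfilter_def by (induction xs) auto

lemma tmember_enc_list [simp]: "tmember x (enc_list g xs) \<longleftrightarrow> x \<in> g ` set xs"
  unfolding tmember_def by (induction xs) auto

lemma tlookup_enc_list:
  assumes "inj g" and "x \<in> set xs"
  shows "tlookup (enc_list (\<lambda>x. Node (g x) (h x)) xs) (g x) = h x"
  using assms(2) unfolding tlookup_def by (induction xs) (auto simp: inj_eq[OF assms(1)])

lemma tappend_enc_list [simp]: "tappend (enc_list g xs) (enc_list g ys) = enc_list g (xs @ ys)"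
  unfolding tappend_def by (induction xs) auto

lemma tfoldl_Node_enc_list: "tfoldl Node (enc_list g xs) (enc_list g ys) = enc_list g (rev xs @ ys)"
proof (induction xs arbitrary: ys)
  case (Cons x xs)
  from Cons.IH[of "x # ys"] show ?case by simp
qed simp

lemma tzip_enc_list [simp]:
  "tzip (enc_list f xs) (enc_list g xs) = enc_list (\<lambda>x. Node (f x) (g x)) xs"
proof -
  define F where "F e s = Node (rgt (lft s)) (Node (Node e (lft (lft s))) (rgt s))" for e s
  \<comment> \<open>Each step pops one element of the reversed second list, so the induction needs a
    remainder \<open>zs\<close> underneath.\<close>
  have "foldr (\<lambda>x. F (f x)) xs (Node (enc_list g (rev xs @ zs)) Leaf) =
      Node (enc_list g zs) (enc_list (\<lambda>x. Node (f x) (g x)) xs)" for zs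
    by (induction xs arbitrary: zs) (auto simp: F_def)
  from this[of "[]"] show ?thesis
    using tfoldl_Node_enc_list[of g xs "[]"] by (simp add: tzip_def F_def[abs_def])
qed

lemma rgt_enc_nat [simp]: "rgt (enc_nat n) = enc_nat (n - 1)"
  by (cases n) auto

lemma enc_nat_eq_Leaf [simp]: "enc_nat n = Leaf \<longleftrightarrow> n = 0"
  by (cases n) auto

lemma tat_most_enc_list [simp]:
  "tat_most P (enc_list g xs) (enc_nat k) \<longleftrightarrow> length (filter (\<lambda>x. P (g x)) xs) \<le> k"
proof -
  have "foldr (\<lambda>x s. if P (g x) then rgt s else s) xs (enc_nat m) =
      enc_nat (m - length (filter (\<lambda>x. P (g x)) xs))" for m
    by (induction xs) auto
  from this[of "Suc k"] show ?thesis
    by (simp add: tat_most_def not_less_eq_eq)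
qed

text \<open>The fold runs from the right and overwrites earlier finds, so it returns the foremost
  pair; this need not be the given one, hence the fresh pair in the conclusion.\<close>

lemma tsearch_enc_list:
  assumes "(a, b) \<in> set (zip xs (tl xs))" and "P (g a) (g b)"
  obtains a b where "(a, b) \<in> set (zip xs (tl xs))" and "P (g a) (g b)"
    and "tsearch P (enc_list g xs) = Node (g a) (g b)"
proof -
  define F where "F e s = Node (Node Leaf e)
     (if lft s \<noteq> Leaf \<and> P e (rgt (lft s)) then Node e (rgt (lft s)) else rgt s)" for e s
  have "(\<exists>a b. (a, b) \<in> set (zip xs (tl xs)) \<and> P (g a) (g b) \<and>
      rgt (foldr (\<lambda>x. F (g x)) xs Leaf) = Node (g a) (g b))"
    using assms
  proof (induction xs)
    case (Cons x xs)
    show ?case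
    proof (cases xs)
      case (Cons y ys)
      have lft: "lft (foldr (\<lambda>x. F (g x)) xs Leaf) = Node Leaf (g y)"
        by (simp add: Cons F_def)
      show ?thesis
      proof (cases "P (g x) (g y)")
        case True
        then have "rgt (foldr (\<lambda>x. F (g x)) (x # xs) Leaf) = Node (g x) (g y)"
          using lft by (simp add: F_def)
        moreover have "(x, y) \<in> set (zip (x # xs) (tl (x # xs)))" by (simp add: Cons)
        ultimately show ?thesis using True by blast
      next
        case False
        then have eq: "rgt (foldr (\<lambda>x. F (g x)) (x # xs) Leaf) = rgt (foldr (\<lambda>x. F (g x)) xs Leaf)"
          using lft by (simp add: F_def[of "g x"])
        have "(a, b) \<in> set (zip xs (tl xs))"
          using Cons.prems False by (auto simp: Cons)
        then have "\<exists>a b. (a, b) \<in> set (zip xs (tl xs)) \<and> P (g a) (g b) \<and>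
            rgt (foldr (\<lambda>x. F (g x)) xs Leaf) = Node (g a) (g b)"
          using Cons.IH Cons.prems(2) by blast
        moreover have "set (zip xs (tl xs)) \<subseteq> set (zip (x # xs) (tl (x # xs)))"
          by (auto simp: Cons)
        ultimately show ?thesis using eq by (metis subsetD)
      qed
    qed (use Cons.prems in auto)
  qed simp
  then show thesis
    using that by (auto simp: tsearch_def F_def[abs_def])
qed

section \<open>The contraction algorithm\<close>

text \<open>A two-level association list keyed by index names: entries are found by comparing names,
  without arithmetic on positions.\<close>

definition ttable :: "tree \<Rightarrow> tree \<Rightarrow> tree" where
  "ttable vs mat = tzip vs (tmap (tzip vs) mat)"

definition tentry :: "tree \<Rightarrow> tree \<Rightarrow> tree \<Rightarrow> tree" where
  "tentry T x y = tlookup (tlookup T x) y"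

definition trow_entry :: "tree \<Rightarrow> tree \<Rightarrow> tree \<Rightarrow> tree \<Rightarrow> tree \<Rightarrow> tree \<Rightarrow> tree" where
  "trow_entry r T u v x y = (if x = u \<and> tentry T u y \<noteq> tentry T v y then r else tentry T x y)"

definition tpair_entry :: "tree \<Rightarrow> tree \<Rightarrow> tree \<Rightarrow> tree \<Rightarrow> tree \<Rightarrow> tree \<Rightarrow> tree" where
  "tpair_entry r T u v x y =
     (if y = u \<and> trow_entry r T u v x u \<noteq> trow_entry r T u v x v then r
      else trow_entry r T u v x y)"

definition tsmall :: "tree \<Rightarrow> tree \<Rightarrow> tree \<Rightarrow> tree \<Rightarrow> tree \<Rightarrow> tree \<Rightarrow> bool" where
  "tsmall r k vs T u v \<longleftrightarrow> tat_most (\<lambda>y. trow_entry r T u v u y = r) vs k"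

definition tcontract :: "tree \<Rightarrow> tree \<Rightarrow> tree \<Rightarrow> tree \<Rightarrow> tree \<Rightarrow> tree \<Rightarrow> tree \<Rightarrow> tree" where
  "tcontract r k l vs T u v = Node k (Node l (Node (tfilter (\<lambda>x. x \<noteq> v) vs)
     (tmap (\<lambda>x. tmap (\<lambda>y. tpair_entry r T u v x y) (tfilter (\<lambda>x. x \<noteq> v) vs))
       (tfilter (\<lambda>x. x \<noteq> v) vs))))"

definition tstep :: "tree \<Rightarrow> tree \<Rightarrow> tree \<Rightarrow> tree" where
  "tstep u v cs =
     Node (Node Leaf (Node u v)) (Node (Node (Node Leaf Leaf) (Node u v)) cs)"

text \<open>The layers from here to \<open>tround\<close> act as let bindings for the pair found and
  for the table.\<close>

definition tround_pair ::
    "tree \<Rightarrow> tree \<Rightarrow> tree \<Rightarrow> tree \<Rightarrow> tree \<Rightarrow> tree \<Rightarrow> tree \<Rightarrow> tree" where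
  "tround_pair r k l vs T cs uv = Node (tcontract r k l vs T (lft uv) (rgt uv))
     (tappend cs (tstep (lft uv) (rgt uv) Leaf))"

definition tround_table ::
    "tree \<Rightarrow> tree \<Rightarrow> tree \<Rightarrow> tree \<Rightarrow> tree \<Rightarrow> tree \<Rightarrow> tree \<Rightarrow> tree" where
  "tround_table r k l vs T cs us =
     tround_pair r k l vs T cs (tsearch (tsmall r k vs T) (tfilter (\<lambda>v. tmember v us) vs))"

text \<open>
  A state \<open>s\<close> of the main loop is \<open>Node inst cs\<close>, with \<open>inst\<close> the encoded current instance and \<open>cs\<close>
  the contractions made so far; \<open>us\<close> is the output of the program that chooses \<open>R\<close>.
\<close>

definition tround :: "tree \<Rightarrow> tree \<Rightarrow> tree \<Rightarrow> tree" where
  "tround r s us = tround_table r (lft (lft s)) (lft (rgt (lft s))) (lft (rgt (rgt (lft s))))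
     (ttable (lft (rgt (rgt (lft s)))) (rgt (rgt (rgt (lft s))))) (rgt s) us"

definition tbig :: "tree \<Rightarrow> bool" where
  "tbig s \<longleftrightarrow> \<not> tat_most (\<lambda>v. True) (lft (rgt (rgt (lft s)))) (lft (rgt (lft s)))"

definition tcontract_to :: "tree \<Rightarrow> tree" where
  "tcontract_to vs = tfoldr (tstep (lft vs)) (rgt vs) Leaf"

lemma polytime_truth_True [polytime_intros]: "polytime (\<lambda>x. truth True)"
  by (rule polytime_const)

lemma polytime_ttable [polytime_intros]:
  assumes "polytime vs" "polytime mat"
  shows "polytime (\<lambda>x. ttable (vs x) (mat x))"
  unfolding ttable_def by (intro polytime_intros assms[THEN polytime_comp] assms)

lemma polytime_tentry [polytime_intros]:
  assumes "polytime T" "polytime a" "polytime b"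
  shows "polytime (\<lambda>x. tentry (T x) (a x) (b x))"
  unfolding tentry_def by (intro polytime_intros assms)

lemma polytime_trow_entry [polytime_intros]:
  assumes "polytime T" "polytime u" "polytime v" "polytime a" "polytime b"
  shows "polytime (\<lambda>x. trow_entry r (T x) (u x) (v x) (a x) (b x))"
  unfolding trow_entry_def by (intro polytime_intros assms)

lemma polytime_tpair_entry [polytime_intros]:
  assumes "polytime T" "polytime u" "polytime v" "polytime a" "polytime b"
  shows "polytime (\<lambda>x. tpair_entry r (T x) (u x) (v x) (a x) (b x))"
  unfolding tpair_entry_def by (intro polytime_intros assms)

lemma polytime_tsmall [polytime_intros]:
  assumes "polytime k" "polytime vs" "polytime T" "polytime u" "polytime v"
  shows "polytime (\<lambda>x. truth (tsmall r (k x) (vs x) (T x) (u x) (v x)))"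
  unfolding tsmall_def by (intro polytime_intros assms assms[THEN polytime_comp])

lemma polytime_tcontract [polytime_intros]:
  assumes "polytime k" "polytime l" "polytime vs" "polytime T" "polytime u" "polytime v"
  shows "polytime (\<lambda>x. tcontract r (k x) (l x) (vs x) (T x) (u x) (v x))"
  unfolding tcontract_def by (intro polytime_intros assms assms[THEN polytime_comp])

lemma polytime_tstep [polytime_intros]:
  assumes "polytime u" "polytime v" "polytime cs"
  shows "polytime (\<lambda>x. tstep (u x) (v x) (cs x))"
  unfolding tstep_def by (intro polytime_intros assms)

lemma polytime_tround_pair [polytime_intros]:
  assumes "polytime k" "polytime l" "polytime vs" "polytime T" "polytime cs" "polytime uv"
  shows "polytime (\<lambda>x. tround_pair r (k x) (l x) (vs x) (T x) (cs x) (uv x))"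
  unfolding tround_pair_def by (intro polytime_intros assms)

lemma polytime_tround_table [polytime_intros]:
  assumes "polytime k" "polytime l" "polytime vs" "polytime T" "polytime cs" "polytime us"
  shows "polytime (\<lambda>x. tround_table r (k x) (l x) (vs x) (T x) (cs x) (us x))"
  unfolding tround_table_def by (intro polytime_intros assms assms[THEN polytime_comp])

lemma polytime_tround: "polytime (\<lambda>x. tround r (lft x) (rgt x))"
  unfolding tround_def by (intro polytime_intros)

lemma polytime_tbig: "polytime (\<lambda>s. truth (tbig s))"
  unfolding tbig_def by (intro polytime_intros)

lemma polytime_tcontract_to: "polytime tcontract_to"
proof -
  have "size (tstep (lft x) e s) \<le> size s + poly [:10, 2:] (size x + size e)" for x e s
    using size_lft_le[of x] by (simp add: tstep_def)
  then show ?thesis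
    unfolding tcontract_to_def by (intro polytime_tfoldr[where c = "[:10, 2:]"] polytime_intros)
qed

section \<open>Agreement of the tree operations with the matrix operations\<close>

lemma enc_inst_order_list:
  "enc_inst fv fe (k, l, M, ord) = Node (enc_nat k) (Node (enc_nat l)
     (Node (enc_list fv (order_list ord (rows M))) (enc_list (\<lambda>u. enc_list (\<lambda>v. fe (entry M u v))
        (order_list ord (rows M))) (order_list ord (rows M)))))"
  by (simp add: Let_def)

lemma tstep_enc:
  "tstep (fv u) (fv v) (enc_list (enc_contraction fv) cs) =
     enc_list (enc_contraction fv) (Rows u v # Cols u v # cs)"
  by (simp add: tstep_def)

lemma tcontract_to_enc:
  assumes "vs \<noteq> []"
  shows "tcontract_to (enc_list fv vs) = enc_list (enc_contraction fv) (contract_to (hd vs) (tl vs))"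
proof -
  have "foldr (\<lambda>v. tstep (fv u) (fv v)) vs Leaf = enc_list (enc_contraction fv) (contract_to u vs)" for u vs
    by (induction vs) (simp_all add: contract_to_def tstep_def)
  then show ?thesis using assms by (cases vs) (auto simp: tcontract_to_def)
qed

context
  fixes A :: "'e set" and r :: 'e and fv :: "'v \<Rightarrow> tree" and fe :: "'e \<Rightarrow> tree"
    and M :: "('v, 'e) matrix" and vs :: "'v list" and T :: tree
  assumes rA: "r \<in> A" and inj: "inj fv" "inj_on fe A"
    and M: "symmetric_matrix A M" and vs: "set vs = rows M" "distinct vs"
    and T: "T = ttable (enc_list fv vs) (enc_list (\<lambda>u. enc_list (\<lambda>v. fe (entry M u v)) vs) vs)"
begin

lemma fe_eq: "x \<in> A \<Longrightarrow> y \<in> A \<Longrightarrow> fe x = fe y \<longleftrightarrow> x = y"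
  using inj(2) by (auto dest: inj_onD)

lemma entry_in: "x \<in> rows M \<Longrightarrow> y \<in> rows M \<Longrightarrow> entry M x y \<in> A"
  using M by (auto simp: symmetric_matrix_def)

lemma tentry_enc:
  assumes "x \<in> rows M" "y \<in> rows M"
  shows "tentry T (fv x) (fv y) = fe (entry M x y)"
  using assms vs(1) by (simp add: T ttable_def tentry_def tlookup_enc_list[OF inj(1)])

text \<open>Comparing codes decides equality of entries because \<open>fe\<close> is injective on
  \<open>A\<close>, which contains all entries of \<open>M\<close> and \<open>r\<close>.\<close>

lemma trow_entry_enc:
  assumes "u \<in> rows M" "v \<in> rows M" "x \<in> rows M" "y \<in> rows M"
  shows "trow_entry (fe r) T (fv u) (fv v) (fv x) (fv y) = fe (entry (contract r (Rows u v) M) x y)"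
  using assms by (simp add: trow_entry_def tentry_enc fe_eq entry_in inj_eq[OF inj(1)])

lemma entry_row_in:
  assumes "u \<in> rows M" "v \<in> rows M" "x \<in> rows M" "y \<in> rows M"
  shows "entry (contract r (Rows u v) M) x y \<in> A"
  using assms rA by (auto simp: entry_in)

text \<open>The column half compares entries of the row-contracted matrix; these lie in
  \<open>A\<close> by \<open>entry_row_in\<close>. That matrix is kept folded so that
  \<open>trow_entry_enc\<close> applies.\<close>

lemma tpair_entry_enc:
  assumes "u \<in> rows M" "v \<in> rows M" "x \<in> rows M" "y \<in> rows M"
  shows "tpair_entry (fe r) T (fv u) (fv v) (fv x) (fv y) = fe (entry (contract_pair r u v M) x y)"
proof -
  have "contract_pair r u v M = contract r (Cols u v) (contract r (Rows u v) M)"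
    by (simp add: contract_pair_def)
  then show ?thesis
    using assms
    by (simp add: tpair_entry_def trow_entry_enc fe_eq entry_row_in inj_eq[OF inj(1)]
        del: contract.simps(1))
qed

lemma tsmall_enc:
  assumes "u \<in> rows M" "v \<in> rows M"
  shows "tsmall (fe r) (enc_nat k) (enc_list fv vs) T (fv u) (fv v) \<longleftrightarrow> pair_red r M u v \<le> k"
proof -
  let ?E = "entry (contract r (Rows u v) M) u"
  have "filter (\<lambda>y. trow_entry (fe r) T (fv u) (fv v) (fv u) (fv y) = fe r) vs =
      filter (\<lambda>y. ?E y = r) vs"
    using assms vs(1) rA
    by (intro filter_cong) (simp_all add: trow_entry_enc fe_eq entry_row_in del: contract.simps)
  \<comment> \<open>The count includes column \<open>v\<close>, as \<open>pair_red\<close> is taken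
    before the column contraction; distinctness turns length into cardinality.\<close>
  moreover have "length (filter (\<lambda>y. ?E y = r) vs) = card {y \<in> rows M. ?E y = r}"
    using vs by (simp add: distinct_length_filter Collect_conj_eq Int_commute)
  moreover have "cols M = rows M" using M by (simp add: symmetric_matrix_def)
  ultimately show ?thesis
    by (simp add: tsmall_def pair_red_def row_red_def)
qed

lemma tcontract_enc:
  assumes "u \<in> rows M" "v \<in> rows M" and ord: "linear_order_on (rows M) ord"
    and vs_ord: "vs = order_list ord (rows M)"
  shows "tcontract (fe r) (enc_nat k) (enc_nat l) (enc_list fv vs) T (fv u) (fv v) =
    enc_inst fv fe (k, l, contract_pair r u v M, Restr ord (rows M - {v}))"
proof -
  let ?vs = "filter (\<lambda>x. x \<noteq> v) vs"
  have fin: "finite (rows M)" using M by (simp add: symmetric_matrix_def)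
  have cong: "enc_list f xs = enc_list g xs" if "\<And>x. x \<in> set xs \<Longrightarrow> f x = g x" for f g and xs :: "'v list"
    using that by (induction xs) auto
  have "enc_list (\<lambda>x. enc_list (\<lambda>y. tpair_entry (fe r) T (fv u) (fv v) (fv x) (fv y)) ?vs) ?vs =
      enc_list (\<lambda>x. enc_list (\<lambda>y. fe (entry (contract_pair r u v M) x y)) ?vs) ?vs"
    using assms(1,2) vs(1) by (intro cong) (auto simp: tpair_entry_enc)
  then show ?thesis
    unfolding enc_inst_order_list
    by (simp add: tcontract_def inj_eq[OF inj(1)] order_list_remove[OF ord fin] flip: vs_ord)
qed

end

text \<open>Filtering the ordered index list by membership in \<open>us\<close> yields
  \<open>R\<close> in increasing order, whatever the order and repetitions in
  \<open>us\<close>.\<close>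

lemma tround_enc:
  assumes I: "(k, l, M, ord) \<in> instances A r choice" and "r \<in> A" and inj: "inj fv" "inj_on fe A"
    and big: "l < card (rows M)" and us: "set us = choice k l M ord"
    and ws: "ws = filter (\<lambda>v. v \<in> choice k l M ord) (order_list ord (rows M))"
  obtains a b where "(a, b) \<in> set (zip ws (tl ws))" and "pair_red r M a b \<le> k"
    and "tround (fe r) (Node (enc_inst fv fe (k, l, M, ord)) (enc_list (enc_contraction fv) cs))
      (enc_list fv us) =
      Node (enc_inst fv fe (k, l, contract_pair r a b M, Restr ord (rows M - {b})))
        (enc_list (enc_contraction fv) (cs @ [Rows a b, Cols a b]))"
proof -
  let ?vs = "order_list ord (rows M)"
  have M: "symmetric_matrix A M" "linear_order_on (rows M) ord"
    using I by (auto simp: instances_def)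
  note vs = instances_order_list(1,2)[OF I]
  define T where
    "T = ttable (enc_list fv ?vs) (enc_list (\<lambda>u. enc_list (\<lambda>v. fe (entry M u v)) ?vs) ?vs)"
  note enc = \<open>r \<in> A\<close> inj M(1) vs T_def
  let ?small = "tsmall (fe r) (enc_nat k) (enc_list fv ?vs) T"
  have small: "?small (fv a) (fv b) \<longleftrightarrow> pair_red r M a b \<le> k"
    if "(a, b) \<in> set (zip ws (tl ws))" for a b
  proof (rule tsmall_enc[OF enc])
    have "a \<in> set ws" using that by (rule set_zip_leftD)
    then show "a \<in> rows M" using vs(1) by (auto simp: ws)
    have "b \<in> set (tl ws)" using that by (rule set_zip_rightD)
    then have "b \<in> set ws" by (cases ws) auto
    then show "b \<in> rows M" using vs(1) by (auto simp: ws)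
  qed
  obtain a' b' where "(a', b') \<in> set (zip ws (tl ws))" "pair_red r M a' b' \<le> k"
    using instances_pair[OF I big ws] .
  then obtain a b where ab: "(a, b) \<in> set (zip ws (tl ws))" "?small (fv a) (fv b)"
    "tsearch ?small (enc_list fv ws) = Node (fv a) (fv b)"
    using tsearch_enc_list[of a' b' ws ?small fv] small by blast
  have le: "pair_red r M a b \<le> k" using ab small by blast
  note rows = instances_contract_pair(2,3)[OF I \<open>r \<in> A\<close> big ws ab(1) le]
  have "tfilter (\<lambda>v. tmember v (enc_list fv us)) (enc_list fv ?vs) = enc_list fv ws"
    using us by (simp add: ws inj_image_mem_iff[OF inj(1)])
  then have "tround (fe r) (Node (enc_inst fv fe (k, l, M, ord)) (enc_list (enc_contraction fv) cs))
      (enc_list fv us) =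
      Node (enc_inst fv fe (k, l, contract_pair r a b M, Restr ord (rows M - {b})))
        (enc_list (enc_contraction fv) (cs @ [Rows a b, Cols a b]))"
    using ab(3) tcontract_enc[OF enc rows M(2) refl, of k l] tstep_enc[of fv a b "[]"]
    unfolding enc_inst_order_list[of fv fe k l M ord]
    by (simp add: tround_def tround_table_def tround_pair_def flip: T_def
        del: enc_list.simps(2) enc_inst.simps)
  then show thesis using that ab(1) le by blast
qed

lemma tbig_enc:
  assumes "(k, l, M, ord) \<in> instances A r choice"
  shows "tbig (Node (enc_inst fv fe (k, l, M, ord)) c) \<longleftrightarrow> l < card (rows M)"
  using instances_order_list(3)[OF assms] by (simp add: tbig_def enc_inst_order_list not_le del: enc_inst.simps)

section \<open>Sizes of encodings, and the main loop\<close>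

lemma size_enc_nat [simp]: "size (enc_nat n) = n"
  by (induction n) auto

lemma size_enc_list_le:
  assumes "\<And>x. x \<in> set xs \<Longrightarrow> size (f x) \<le> K"
  shows "size (enc_list f xs) \<le> length xs * (K + 1)"
  using assms by (induction xs) force+

lemma length_le_size_enc_list: "length xs \<le> size (enc_list f xs)"
  by (induction xs) auto

lemma size_le_size_enc_list: "x \<in> set xs \<Longrightarrow> size (f x) \<le> size (enc_list f xs)"
  by (induction xs) auto

lemma size_enc_list_filter: "size (enc_list f (filter P xs)) \<le> size (enc_list f xs)"
  by (induction xs) auto

lemma size_enc_list_append: "size (enc_list f (xs @ ys)) = size (enc_list f xs) + size (enc_list f ys)"
  by (induction xs) auto

lemma size_enc_inst_le:
  assumes I: "(k, l, M, ord) \<in> instances A r choice" and K: "\<And>x. x \<in> A \<Longrightarrow> size (fe x) \<le> K"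
  shows "size (enc_inst fv fe (k, l, M, ord)) \<le>
    3 + k + l + size (enc_list fv (order_list ord (rows M))) +
      card (rows M) * (card (rows M) * (K + 1) + 1)"
proof -
  let ?vs = "order_list ord (rows M)"
  note vs = instances_order_list[OF I]
  have "entry M u v \<in> A" if "u \<in> rows M" "v \<in> rows M" for u v
    using I that by (auto simp: instances_def symmetric_matrix_def)
  then have row: "size (enc_list (\<lambda>v. fe (entry M u v)) ?vs) \<le> length ?vs * (K + 1)"
    if "u \<in> set ?vs" for u
    using that vs(1) by (intro size_enc_list_le K) auto
  have "size (enc_list (\<lambda>u. enc_list (\<lambda>v. fe (entry M u v)) ?vs) ?vs) \<le>
      length ?vs * (length ?vs * (K + 1) + 1)"
    by (rule size_enc_list_le) (rule row)
  then show ?thesis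
    unfolding enc_inst_order_list using vs(3) by simp
qed

lemma poly_time_contraction_if_choice:
  fixes A :: "'e set" and choice :: "nat \<Rightarrow> nat \<Rightarrow> ('v, 'e) matrix \<Rightarrow> 'v rel \<Rightarrow> 'v set"
  assumes "finite A" and "r \<in> A" and inj: "inj fv" "inj_on fe A"
    and choice: "poly_time_choice fv fe A r choice"
  shows "poly_time_contraction fv fe A r choice"
proof -
  obtain K where K: "size (fe x) \<le> K" if "x \<in> A" for x
    using \<open>finite A\<close> finite_nat_set_iff_bounded_le[of "(\<lambda>x. size (fe x)) ` A"] by auto
  let ?I = "instances A r choice"
  let ?e = "\<lambda>(I, cs). Node (enc_inst fv fe I) (enc_list (enc_contraction fv) cs)"
  let ?S = "?I \<times> (UNIV :: 'v contraction list set)"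
  let ?us = "\<lambda>((k, l, M, ord), cs :: 'v contraction list). {enc_list fv us | us. set us = choice k l M ord}"
  let ?B = "\<lambda>s. {tround (fe r) (?e s) y | y. y \<in> ?us s}"
  define size_vs where "size_vs M ord = size (enc_list fv (order_list ord (rows M)))"
    for M :: "('v, 'e) matrix" and ord
  \<comment> \<open>Each round deletes one row, so \<open>i\<close> rounds are left. A round records
    two contractions naming two indices each, whence four names plus a constant (20 is generous),
    reserved in advance for every remaining round. As \<open>cs\<close> alone is not yet a
    contraction sequence, its correctness is stated through all continuations.\<close>
  define J where "J x i s \<longleftrightarrow> (case (x, s) of ((k, l, M, ord), (I', cs)) \<Rightarrow>
      \<exists>M' ord'. I' = (k, l, M', ord') \<and> I' \<in> ?I \<and> i = card (rows M') - l \<and>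
        card (rows M') \<le> card (rows M) \<and> size_vs M' ord' \<le> size_vs M ord \<and>
        size (enc_list (enc_contraction fv) cs) + i * (4 * size_vs M ord + 20) \<le>
          card (rows M) * (4 * size_vs M ord + 20) \<and>
        (\<forall>cs'. symmetric_d_contraction_sequence r l M' cs' \<longrightarrow>
           symmetric_d_contraction_sequence r l M (cs @ cs')))"
    for x i s
  have card_le: "card (rows M) \<le> size_vs M ord" if "(k, l, M, ord) \<in> ?I" for k l M ord
    using instances_order_list(3)[OF that] length_le_size_enc_list by (metis size_vs_def)
  have size_vs_le: "3 + k + l + size_vs M ord \<le> size (enc_inst fv fe (k, l, M, ord))" for k l M ord
    unfolding enc_inst_order_list size_vs_def by simp
  have big_iff: "truth (tbig (?e s)) = Leaf \<longleftrightarrow> card (rows M') \<le> l'"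
    if "s = ((k', l', M', ord'), cs)" "(k', l', M', ord') \<in> ?I" for s k' l' M' ord' cs
    using tbig_enc[OF that(2)] by (simp add: that(1) not_less del: enc_inst.simps)
  have "poly_time_on ?I (\<lambda>x. Node (enc_inst fv fe x) Leaf) (\<lambda>x. {?e s | s. J x 0 s})"
  proof (rule poly_time_on_while[where S = ?S and c = "\<lambda>s. truth (tbig (?e s))" and B = ?B and
        n = "\<lambda>(k, l, M, ord). card (rows M) - l" and N = "[:0, 1:]" and
        b = "[:1, 1:] + [:0, 1:] * ([:0, K + 1:] + 1) + [:0, 1:] * [:20, 4:]"])
    show "poly_time_on ?S ?e (\<lambda>s. {truth (tbig (?e s))})"
      using polytime_tbig by (rule poly_time_on_polytime)
  next
    let ?D = "{s \<in> ?S. truth (tbig (?e s)) \<noteq> Leaf}"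
    \<comment> \<open>The loop test guarantees more than \<open>l\<close> rows, which puts the
      current instance in the domain of the choice program.\<close>
    have "poly_time_on ?D ?e ?us"
    proof (rule poly_time_on_comp)
      show "poly_time_on ?D ?e (\<lambda>s. {lft (?e s)})"
        by (intro poly_time_on_polytime polytime_intros)
      show "poly_time_on {(k, l, M, ord) \<in> ?I. l < card (rows M)} (enc_inst fv fe)
          (\<lambda>(k, l, M, ord). {enc_list fv us | us. set us = choice k l M ord})"
        using choice by (simp add: poly_time_choice_def)
    next
      fix s y assume s: "s \<in> ?D" and y: "y \<in> {lft (?e s)}"
      obtain k l M ord cs where seq: "s = ((k, l, M, ord), cs)" by (cases s, cases "fst s" rule: prod_cases4) auto
      show "\<exists>z\<in>{(k, l, M, ord) \<in> ?I. l < card (rows M)}. y = enc_inst fv fe z \<and>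
          (\<lambda>(k, l, M, ord). {enc_list fv us | us. set us = choice k l M ord}) z \<subseteq> ?us s"
        using s y big_iff[OF seq]
        by (intro bexI[of _ "(k, l, M, ord)"]) (auto simp: seq not_le simp del: enc_inst.simps)
    qed
    \<comment> \<open>The choice program consumes its input, so a copy of the state is paired with
      its output.\<close>
    with poly_time_on_polytime[OF polytime_id]
    have "poly_time_on ?D ?e (\<lambda>s. {Node y z | y z. y \<in> {?e s} \<and> z \<in> ?us s})"
      by (rule poly_time_on_Pair)
    then show "poly_time_on ?D ?e ?B"
      by (rule poly_time_on_image[OF _ polytime_tround[of "fe r"]]) auto
  next
    fix x assume "x \<in> ?I"
    then show "\<exists>s. Node (enc_inst fv fe x) Leaf = ?e s \<and>
        J x ((\<lambda>(k, l, M, ord). card (rows M) - l) x) s"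
      by (intro exI[of _ "(x, [])"]) (auto simp: J_def split: prod.splits simp del: enc_inst.simps)
  next
    fix x assume x: "x \<in> ?I"
    obtain k l M ord where "x = (k, l, M, ord)" by (metis prod_cases4)
    then show "(\<lambda>(k, l, M, ord). card (rows M) - l) x \<le>
        poly [:0, 1:] (size (Node (enc_inst fv fe x) Leaf))"
      using x card_le[of k l M ord] size_vs_le[of k l M ord] by (simp del: enc_inst.simps)
  next
    fix x i s assume x: "x \<in> ?I" and J: "J x i s"
    obtain k l M ord where xeq: "x = (k, l, M, ord)" by (metis prod_cases4)
    obtain M' ord' cs where s: "s = ((k, l, M', ord'), cs)" "(k, l, M', ord') \<in> ?I"
      "card (rows M') \<le> card (rows M)" "size_vs M' ord' \<le> size_vs M ord"
      "size (enc_list (enc_contraction fv) cs) + i * (4 * size_vs M ord + 20) \<le>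
          card (rows M) * (4 * size_vs M ord + 20)"
      using J unfolding J_def xeq by (auto split: prod.splits)
    let ?m = "size (enc_inst fv fe x)"
    have m: "3 + k + l + size_vs M ord \<le> ?m" "card (rows M) \<le> ?m"
      using size_vs_le[of k l M ord] card_le[of k l M ord] x by (simp_all add: xeq del: enc_inst.simps)
    have "size (enc_inst fv fe (k, l, M', ord')) \<le>
        3 + k + l + size_vs M' ord' + card (rows M') * (card (rows M') * (K + 1) + 1)"
      unfolding size_vs_def by (rule size_enc_inst_le[OF s(2) K])
    also have "\<dots> \<le> ?m + ?m * (?m * (K + 1) + 1)"
      using m s(3,4) by (intro add_mono mult_le_mono) auto
    finally have inst: "size (enc_inst fv fe (k, l, M', ord')) \<le> ?m + ?m * (?m * (K + 1) + 1)" .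
    have "size (enc_list (enc_contraction fv) cs) \<le> card (rows M) * (4 * size_vs M ord + 20)"
      using s(5) by linarith
    also have "\<dots> \<le> ?m * (4 * ?m + 20)"
      using m by (intro mult_le_mono) auto
    finally have cs: "size (enc_list (enc_contraction fv) cs) \<le> ?m * (4 * ?m + 20)" .
    \<comment> \<open>The summands bound, in this order, the outer node with index names and
      parameters, the matrix entries, and the recorded contractions.\<close>
    let ?b = "[:1, 1:] + [:0, 1:] * ([:0, K + 1:] + 1) + [:0, 1:] * [:20, 4:] :: nat poly"
    have "size (?e s) \<le> poly ?b ?m"
      using inst cs by (simp add: s(1) algebra_simps del: enc_inst.simps)
    also have "\<dots> \<le> poly ?b (size (Node (enc_inst fv fe x) Leaf))"
      by (rule poly_nat_mono) simp
    finally show "s \<in> ?S \<and> size (?e s) \<le> poly ?b (size (Node (enc_inst fv fe x) Leaf))"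
      using s(1,2) by blast
  next
    fix x i s y assume x: "x \<in> ?I" and J: "J x (Suc i) s" and y: "y \<in> ?B s"
    obtain k l M ord where xeq: "x = (k, l, M, ord)" by (metis prod_cases4)
    obtain I' cs where seq: "s = (I', cs)" by (cases s)
    obtain M' ord' where I': "I' = (k, l, M', ord')" and s: "I' \<in> ?I"
      "Suc i = card (rows M') - l"
      "card (rows M') \<le> card (rows M)" "size_vs M' ord' \<le> size_vs M ord"
      "size (enc_list (enc_contraction fv) cs) + Suc i * (4 * size_vs M ord + 20) \<le>
          card (rows M) * (4 * size_vs M ord + 20)"
      "\<forall>cs'. symmetric_d_contraction_sequence r l M' cs' \<longrightarrow>
           symmetric_d_contraction_sequence r l M (cs @ cs')"
      using J unfolding J_def xeq seq prod.case by (elim exE conjE)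
    note s = seq[unfolded I'] s(1)[unfolded I'] s(3,4,5,2) s(6)[rule_format]
    obtain us where us: "set us = choice k l M' ord'" "y = tround (fe r) (?e s) (enc_list fv us)"
      using y by (auto simp: s(1) simp del: enc_inst.simps)
    have big: "l < card (rows M')" using s(6) by simp
    obtain a b where
      ab: "(a, b) \<in> set (zip (filter (\<lambda>v. v \<in> choice k l M' ord') (order_list ord' (rows M')))
         (tl (filter (\<lambda>v. v \<in> choice k l M' ord') (order_list ord' (rows M')))))"
        "pair_red r M' a b \<le> k" and
      yeq: "y = ?e ((k, l, contract_pair r a b M', Restr ord' (rows M' - {b})),
        cs @ [Rows a b, Cols a b])"
      using tround_enc[OF s(2) \<open>r \<in> A\<close> inj big us(1) refl, of cs] us(2) unfolding s(1) split_conv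
      by metis
    note step = instances_contract_pair[OF s(2) \<open>r \<in> A\<close> big refl ab]
    let ?M = "contract_pair r a b M'" and ?ord = "Restr ord' (rows M' - {b})"
    let ?cs = "cs @ [Rows a b, Cols a b]"
    have M': "linear_order_on (rows M') ord'" "finite (rows M')" "cols M' = rows M'"
      using s(2) by (auto simp: instances_def symmetric_matrix_def)
    have card: "card (rows ?M) = card (rows M') - 1"
      using step(3) by (simp add: card_Diff_singleton)
    have "size_vs ?M ?ord \<le> size_vs M' ord'"
      unfolding size_vs_def rows_contract_pair order_list_remove[OF M'(1,2)]
      by (rule size_enc_list_filter)
    moreover have "size (enc_list (enc_contraction fv) ?cs) + i * (4 * size_vs M ord + 20) \<le>
        card (rows M) * (4 * size_vs M ord + 20)"
    proof -
      have "size (fv v) \<le> size_vs M ord" if "v \<in> rows M'" for v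
        using size_le_size_enc_list[of v "order_list ord' (rows M')" fv] s(4) that
          instances_order_list(1)[OF s(2)] by (simp add: size_vs_def)
      then have "size (fv a) \<le> size_vs M ord" "size (fv b) \<le> size_vs M ord"
        using step(2,3) by blast+
      then have "size (enc_list (enc_contraction fv) [Rows a b, Cols a b]) \<le> 4 * size_vs M ord + 20"
        by simp
      then show ?thesis using s(5) by (simp add: size_enc_list_append del: enc_list.simps)
    qed
    \<comment> \<open>A continuation for the contracted matrix, preceded by the new pair of
      contractions, is a continuation for \<open>M'\<close>.\<close>
    moreover have "symmetric_d_contraction_sequence r l M (?cs @ cs')"
      if "symmetric_d_contraction_sequence r l ?M cs'" for cs'
      using s(7)[OF symmetric_d_contraction_sequence_Cons[OF M'(3) step(2-5) that]] by simp
    ultimately have "J x i ((k, l, ?M, ?ord), ?cs)"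
      unfolding J_def xeq using s(3,4,6) step(1) card by auto
    then show "\<exists>s'. y = ?e s' \<and> J x i s'" using yeq by blast
  next
    fix x i s assume "x \<in> ?I" and J: "J x (Suc i) s"
    obtain k l M' ord' cs where "s = ((k, l, M', ord'), cs)" "(k, l, M', ord') \<in> ?I"
      "l < card (rows M')"
      using J unfolding J_def by (auto split: prod.splits)
    then show "truth (tbig (?e s)) \<noteq> Leaf" using big_iff by (simp add: not_le del: enc_inst.simps)
  next
    fix x s assume "x \<in> ?I" and J: "J x 0 s"
    obtain k l M' ord' cs where "s = ((k, l, M', ord'), cs)" "(k, l, M', ord') \<in> ?I"
      "card (rows M') \<le> l"
      using J unfolding J_def by (auto split: prod.splits)
    then show "truth (tbig (?e s)) = Leaf" using big_iff by blast
  qed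
  note loop = this
  have init: "poly_time_on ?I (enc_inst fv fe) (\<lambda>x. {Node (enc_inst fv fe x) Leaf})"
    by (rule poly_time_on_polytime[where f = "\<lambda>x. Node x Leaf"]) (intro polytime_intros)
  have "poly_time_on ?I (enc_inst fv fe) (\<lambda>x. {?e s | s. J x 0 s})"
    by (rule poly_time_on_comp[OF init loop]) blast
  then show ?thesis
    unfolding poly_time_contraction_def
  proof (rule poly_time_on_image)
    \<comment> \<open>The tree read by \<open>tcontract_to\<close> is the list of the at most
      \<open>l\<close> indices left; its contractions complete those in
      \<open>rgt s\<close>.\<close>
    show "polytime (\<lambda>s. tappend (rgt s) (tcontract_to (lft (rgt (rgt (lft s))))))"
      by (intro polytime_intros polytime_tcontract_to[THEN polytime_comp])
  next
    fix x y assume x: "x \<in> ?I" and y: "y \<in> {?e s | s. J x 0 s}"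
    obtain k l M ord where xeq: "x = (k, l, M, ord)" by (metis prod_cases4)
    obtain M' ord' cs where I': "(k, l, M', ord') \<in> ?I" "card (rows M') \<le> l"
      "\<And>cs'. symmetric_d_contraction_sequence r l M' cs' \<Longrightarrow>
           symmetric_d_contraction_sequence r l M (cs @ cs')"
      and yeq: "y = ?e ((k, l, M', ord'), cs)"
      using y unfolding J_def xeq by (auto split: prod.splits simp del: enc_inst.simps)
    let ?vs = "order_list ord' (rows M')"
    note fin = instances_contract_to[OF I'(1) \<open>r \<in> A\<close> I'(2) refl]
    have "tappend (rgt y) (tcontract_to (lft (rgt (rgt (lft y))))) =
        enc_list (enc_contraction fv) (cs @ contract_to (hd ?vs) (tl ?vs))"
      using tcontract_to_enc[OF fin(1), of fv]
      by (simp add: yeq enc_inst_order_list del: enc_inst.simps)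
    then show "tappend (rgt y) (tcontract_to (lft (rgt (rgt (lft y))))) \<in>
        (\<lambda>(k, l, M, ord). {enc_list (enc_contraction fv) cs | cs.
          symmetric_d_contraction_sequence r l M cs}) x"
      using I'(3)[OF fin(2)] unfolding xeq by blast
  qed
qed

theorem proposition6p2:
  fixes A :: "'e set" and r :: 'e
  assumes "finite A" and "r \<in> A"
  shows "(\<forall>k l (M :: ('v, 'e) matrix) ord.
            k \<le> l \<longrightarrow> symmetric_matrix A M \<longrightarrow> linear_order_on (rows M) ord \<longrightarrow>
            red_potential_property r k l M ord \<longrightarrow>
            (\<exists>cs. symmetric_d_contraction_sequence r l M cs)) \<and>
         (\<forall>(choice :: nat \<Rightarrow> nat \<Rightarrow> ('v, 'e) matrix \<Rightarrow> 'v rel \<Rightarrow> 'v set)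
            (fv :: 'v \<Rightarrow> tree) (fe :: 'e \<Rightarrow> tree).
            inj fv \<longrightarrow> inj_on fe A \<longrightarrow>
            poly_time_choice fv fe A r choice \<longrightarrow> poly_time_contraction fv fe A r choice)"
proof (intro conjI allI impI)
  fix k l and M :: "('v, 'e) matrix" and ord
  assume *: "k \<le> l" "symmetric_matrix A M" "linear_order_on (rows M) ord"
    "red_potential_property r k l M ord"
  have "finite (rows M)" using *(2) by (simp add: symmetric_matrix_def)
  \<comment> \<open>A choice function extracted from the property turns \<open>M\<close> into an
    instance, so the first claim rests on the same round as the algorithm.\<close>
  then obtain choice where "red_potential_property_by choice r k l M ord"
    using *(4) red_potential_property_iff_by[of M r k l ord] by blast
  with * have "(k, l, M, ord) \<in> instances A r (\<lambda>_ _. choice)" by (simp add: instances_def)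
  then show "\<exists>cs. symmetric_d_contraction_sequence r l M cs"
    using \<open>r \<in> A\<close> by (rule instances_contraction_sequence)
qed (use assms in \<open>blast intro: poly_time_contraction_if_choice\<close>)

end
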